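(* Let $s\ge1$, $N\in\mathbb N$, and let $\alpha_1,\dots,\alpha_{s+1},\beta$ be real with $\alpha_1-1>\beta>0$ and $\alpha_i>1$ for $2\le i\le s+1$. Let $\mathbf n,\mathbf m\in\mathbb N^s$ with $\sum_in_i\le N$ and $\sum_im_i\le N$. Then the multivariate Bannai--Ito polynomials satisfy $$\sum_{\ell_s=0}^N\sum_{\ell_{s-1}=0}^{\ell_s}\cdots\sum_{\ell_1=0}^{\ell_2}\Omega(\boldsymbol\ell,\mathbf n;\boldsymbol\alpha,\beta,N)\,B_{\mathbf n}(\boldsymbol\ell;\boldsymbol\alpha,\beta,N)\,B_{\mathbf m}(\boldsymbol\ell;\boldsymbol\alpha,\beta,N)=H(\mathbf n;\boldsymbol\alpha,\beta,N)\,\delta_{\mathbf n,\mathbf m},$$ where, with $\ell_{s+1}=N$ and $w^{(i)}$, $h^{(i)}$ as in the context, $$\Omega(\boldsymbol\ell,\mathbf n;\boldsymbol\alpha,\beta,N)=\frac{\prod_{i=1}^sw^{(i)}_{\ell_i-N_{i-1}}}{\prod_{i=1}^{s-1}h^{(i)}_{n_i}},\qquad H(\mathbf n;\boldsymbol\alpha,\beta,N)=h^{(s)}_{n_s}.$$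
   Context: Notation: $(a)_m=\prod_{t=0}^{m-1}(a+t)$; $\alpha_{[i;j]}=\alpha_i+\dots+\alpha_j$ (zero if $i>j$); $N_k=n_1+\dots+n_k$, $N_0=0$; any $m\in\mathbb N$ is written $m=2m_e+m_p$ with $m_e\in\mathbb N$, $m_p\in\{0,1\}$. Univariate Bannai--Ito polynomials $B_m(x)=B_m(x;\rho_1,\rho_2,r_1,r_2)$: $B_{-1}=0$, $B_0=1$, $xB_m(x)=B_{m+1}(x)+(\rho_1-A_m-C_m)B_m(x)+A_{m-1}C_mB_{m-1}(x)$ with $$A_m=\frac{(m+2\rho_1-2r_1+m_p(2\rho_2-2r_2)+1)(m+2\rho_1-2r_2+m_p(2r_2+2\rho_2)+1)}{4(m+\rho_1+\rho_2-r_1-r_2+1)},$$ $$C_m=-\frac{(m+m_p(2\rho_2-2r_2))(m-2r_1-2r_2+m_p(2r_2+2\rho_2))}{4(m+\rho_1+\rho_2-r_1-r_2)}.$$ Multivariate: for $\mathbf n\in\mathbb N^s$ and integers $x_1,\dots,x_s$, $x_{s+1}=N$, $$B_{\mathbf n}(\mathbf x;\boldsymbol\alpha,\beta,N)=\prod_{k=1}^sB_{n_k}\Big(\tfrac{(-1)^{N_{k-1}+x_k}}2\big(x_k+\tfrac{\alpha_{[1;k]}}2\big)-\tfrac14;\rho_1^{(k)},\rho_2^{(k)},r_1^{(k)},r_2^{(k)}\Big),$$ with $X_k=\frac{(-1)^{N_{k-1}+x_{k+1}}}2\big(x_{k+1}+\frac{\alpha_{[1;k+1]}}2\big)$ and $\rho_1^{(k)}=\frac{N_{k-1}}2+\frac{\alpha_{[1;k]}-1}4$,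 $\rho_2^{(k)}=X_k+\frac{\alpha_{k+1}-1}4$, $r_1^{(k)}=X_k-\frac{\alpha_{k+1}-1}4$, $r_2^{(k)}=-\frac{N_{k-1}}2+\frac{\alpha_1-\alpha_{[2;k]}-1}4-\frac\beta2$. Weights: $w^{(i)}_{\ell_i-N_{i-1}}=0$ if $\ell_i<N_{i-1}$, and $\Omega:=0$ whenever some numerator factor $w^{(i)}$ vanishes for this reason. Otherwise put $k=\ell_i-N_{i-1}$, $M=\ell_{i+1}-N_{i-1}$, $m=n_i$, $X=\frac{(-1)^{N_{i-1}+\ell_{i+1}}}2\big(\ell_{i+1}+\frac{\alpha_{[1;i+1]}}2\big)$, and let $\rho_1=\frac{N_{i-1}}2+\frac{\alpha_{[1;i]}-1}4$, $\rho_2=X+\frac{\alpha_{i+1}-1}4$, $r_1=X-\frac{\alpha_{i+1}-1}4$, $r_2=-\frac{N_{i-1}}2+\frac{\alpha_1-\alpha_{[2;i]}-1}4-\frac\beta2$ (that is, $\rho_a=\rho_a^{(i)}$, $r_a=r_a^{(i)}$ evaluated at $\mathbf n$ and $x_{i+1}=\ell_{i+1}$); then $$w^{(i)}_k=(-1)^{k_p}\frac{(\rho_1+\rho_2+1)_{k_e}(\rho_1-r_1+\frac12)_{k_e+k_p}(\rho_1-r_2+\frac12)_{k_e+k_p}(2\rho_1+1)_{k_e}}{k_e!\,(\rho_1+r_2+\frac12)_{k_e+k_p}(\rho_1+r_1+\frac12)_{k_e+k_p}(\rho_1-\rho_2+1)_{k_e}},$$ $$h^{(i)}_{m}=\frac{M_e!\,m_e!}{(M_e-m_e-m_p(1-M_p))!}\cdot\frac{(\rho_1+\rho_2-r_1-r_2+m_e+1)_{M_e+M_p-m_e}}{(\rho_2-r_1+m_e+m_p+\frac12)_{M_e+M_p-m_e-m_p}}$$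 $$\times\frac{(2\rho_1+1)_{M_e+M_p}\,\big(M_p(\rho_1-\rho_2-r_1+r_2)+\rho_2-r_2+\frac12\big)_{m_e+m_p}}{(\rho_1+r_2+\frac12)_{M_e-m_e+M_p(1-m_p)}\,\big((\rho_1+\rho_2-r_1-r_2+m_e+1)_{m_e+m_p}\big)^2}$$ $$\times(\rho_1-r_2+\tfrac12)_{m_e+m_p}\big(-M_p(\rho_1+\rho_2+r_1+r_2)+\rho_1+\rho_2+1\big)_{m_e}.$$ *)

theory Defs
  imports Complex_Main
begin

text \<open>
  Multi-indices, parameter vectors and grid points are functions on the naturals of which
  only the entries with index 1 up to s (up to s + 1 for \<open>\<alpha>\<close>) matter.
  For a natural number m, the decomposition \<open>m = 2 m\<^sub>e + m\<^sub>p\<close> is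
  \<open>m\<^sub>e = m div 2\<close>, \<open>m\<^sub>p = m mod 2\<close>.
\<close>

abbreviation epart :: "nat \<Rightarrow> nat" where "epart m \<equiv> m div 2"
abbreviation ppart :: "nat \<Rightarrow> nat" where "ppart m \<equiv> m mod 2"

definition asum :: "(nat \<Rightarrow> real) \<Rightarrow> nat \<Rightarrow> nat \<Rightarrow> real" where
  "asum \<alpha> i j = (\<Sum>t=i..j. \<alpha> t)"

definition psum :: "(nat \<Rightarrow> nat) \<Rightarrow> nat \<Rightarrow> nat" where
  "psum n k = (\<Sum>t=1..k. n t)"


subsection \<open>Univariate Bannai--Ito polynomials\<close>

definition BI_A :: "real \<Rightarrow> real \<Rightarrow> real \<Rightarrow> real \<Rightarrow> nat \<Rightarrow> real" where
  "BI_A \<rho>1 \<rho>2 r1 r2 m =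
     (real m + 2*\<rho>1 - 2*r1 + real (ppart m) * (2*\<rho>2 - 2*r2) + 1)
     * (real m + 2*\<rho>1 - 2*r2 + real (ppart m) * (2*r2 + 2*\<rho>2) + 1)
     / (4 * (real m + \<rho>1 + \<rho>2 - r1 - r2 + 1))"

definition BI_C :: "real \<Rightarrow> real \<Rightarrow> real \<Rightarrow> real \<Rightarrow> nat \<Rightarrow> real" where
  "BI_C \<rho>1 \<rho>2 r1 r2 m =
     - ((real m + real (ppart m) * (2*\<rho>2 - 2*r2))
        * (real m - 2*r1 - 2*r2 + real (ppart m) * (2*r2 + 2*\<rho>2))
        / (4 * (real m + \<rho>1 + \<rho>2 - r1 - r2)))"

text \<open>
  The three-term recurrence solved for the polynomial of highest degree; the second equation
  is its instance for m = 0, where the last term is absent because \<open>B\<^sub>-\<^sub>1 = 0\<close>.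
\<close>

fun BI :: "real \<Rightarrow> real \<Rightarrow> real \<Rightarrow> real \<Rightarrow> nat \<Rightarrow> real \<Rightarrow> real" where
  "BI \<rho>1 \<rho>2 r1 r2 0 x = 1"
| "BI \<rho>1 \<rho>2 r1 r2 (Suc 0) x = x - (\<rho>1 - BI_A \<rho>1 \<rho>2 r1 r2 0 - BI_C \<rho>1 \<rho>2 r1 r2 0)"
| "BI \<rho>1 \<rho>2 r1 r2 (Suc (Suc m)) x =
     (x - (\<rho>1 - BI_A \<rho>1 \<rho>2 r1 r2 (Suc m) - BI_C \<rho>1 \<rho>2 r1 r2 (Suc m)))
       * BI \<rho>1 \<rho>2 r1 r2 (Suc m) x
     - BI_A \<rho>1 \<rho>2 r1 r2 m * BI_C \<rho>1 \<rho>2 r1 r2 (Suc m) * BI \<rho>1 \<rho>2 r1 r2 m x"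


subsection \<open>Parameters and multivariate polynomials\<close>

text \<open>
  In the following definitions the index k is at least 1, and y stands for the value of
  \<open>x\<^sub>k\<^sub>+\<^sub>1\<close>.
\<close>

definition XX :: "(nat \<Rightarrow> real) \<Rightarrow> (nat \<Rightarrow> nat) \<Rightarrow> nat \<Rightarrow> int \<Rightarrow> real" where
  "XX \<alpha> n k y =
     (-1) powi (int (psum n (k - 1)) + y) / 2 * (real_of_int y + asum \<alpha> 1 (k + 1) / 2)"

definition rho1 :: "(nat \<Rightarrow> real) \<Rightarrow> (nat \<Rightarrow> nat) \<Rightarrow> nat \<Rightarrow> real" where
  "rho1 \<alpha> n k = real (psum n (k - 1)) / 2 + (asum \<alpha> 1 k - 1) / 4"

definition rho2 :: "(nat \<Rightarrow> real) \<Rightarrow> (nat \<Rightarrow> nat) \<Rightarrow> nat \<Rightarrow> int \<Rightarrow> real" where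
  "rho2 \<alpha> n k y = XX \<alpha> n k y + (\<alpha> (k + 1) - 1) / 4"

definition rr1 :: "(nat \<Rightarrow> real) \<Rightarrow> (nat \<Rightarrow> nat) \<Rightarrow> nat \<Rightarrow> int \<Rightarrow> real" where
  "rr1 \<alpha> n k y = XX \<alpha> n k y - (\<alpha> (k + 1) - 1) / 4"

definition rr2 :: "(nat \<Rightarrow> real) \<Rightarrow> real \<Rightarrow> (nat \<Rightarrow> nat) \<Rightarrow> nat \<Rightarrow> real" where
  "rr2 \<alpha> \<beta> n k =
     - (real (psum n (k - 1)) / 2) + (\<alpha> 1 - asum \<alpha> 2 k - 1) / 4 - \<beta> / 2"

definition multiBI ::
  "nat \<Rightarrow> (nat \<Rightarrow> nat) \<Rightarrow> (nat \<Rightarrow> int) \<Rightarrow> (nat \<Rightarrow> real) \<Rightarrow> real \<Rightarrow> nat \<Rightarrow> real" where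
  "multiBI s n x \<alpha> \<beta> N =
     (let x' = x(s + 1 := int N) in
      \<Prod>k=1..s.
        BI (rho1 \<alpha> n k) (rho2 \<alpha> n k (x' (k + 1))) (rr1 \<alpha> n k (x' (k + 1))) (rr2 \<alpha> \<beta> n k) (n k)
          ((-1) powi (int (psum n (k - 1)) + x' k) / 2
             * (real_of_int (x' k) + asum \<alpha> 1 k / 2) - 1 / 4))"


subsection \<open>Weights and norms\<close>

definition BI_w :: "real \<Rightarrow> real \<Rightarrow> real \<Rightarrow> real \<Rightarrow> nat \<Rightarrow> real" where
  "BI_w \<rho>1 \<rho>2 r1 r2 k =
     (-1) ^ ppart k *
     (pochhammer (\<rho>1 + \<rho>2 + 1) (epart k)
      * pochhammer (\<rho>1 - r1 + 1/2) (epart k + ppart k)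
      * pochhammer (\<rho>1 - r2 + 1/2) (epart k + ppart k)
      * pochhammer (2*\<rho>1 + 1) (epart k))
     / (fact (epart k)
        * pochhammer (\<rho>1 + r2 + 1/2) (epart k + ppart k)
        * pochhammer (\<rho>1 + r1 + 1/2) (epart k + ppart k)
        * pochhammer (\<rho>1 - \<rho>2 + 1) (epart k))"

text \<open>
  Meaningful for \<open>m \<le> M\<close>, in which case none of the natural-number subtractions truncates.
  This always holds where the function is used below: \<open>M = l\<^sub>i\<^sub>+\<^sub>1 - N\<^sub>i\<^sub>-\<^sub>1\<close>
  and \<open>m = n\<^sub>i\<close> with \<open>N\<^sub>i \<le> l\<^sub>i\<^sub>+\<^sub>1\<close>.
\<close>

definition BI_h :: "real \<Rightarrow> real \<Rightarrow> real \<Rightarrow> real \<Rightarrow> nat \<Rightarrow> nat \<Rightarrow> real" where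
  "BI_h \<rho>1 \<rho>2 r1 r2 M m =
     (fact (epart M) * fact (epart m)) / fact (epart M - epart m - ppart m * (1 - ppart M))
     * (pochhammer (\<rho>1 + \<rho>2 - r1 - r2 + real (epart m) + 1) (epart M + ppart M - epart m)
        / pochhammer (\<rho>2 - r1 + real (epart m) + real (ppart m) + 1/2)
            (epart M + ppart M - epart m - ppart m))
     * (pochhammer (2*\<rho>1 + 1) (epart M + ppart M)
        * pochhammer (real (ppart M) * (\<rho>1 - \<rho>2 - r1 + r2) + \<rho>2 - r2 + 1/2) (epart m + ppart m)
        / (pochhammer (\<rho>1 + r2 + 1/2) (epart M - epart m + ppart M * (1 - ppart m))
           * (pochhammer (\<rho>1 + \<rho>2 - r1 - r2 + real (epart m) + 1) (epart m + ppart m))\<^sup>2))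
     * pochhammer (\<rho>1 - r2 + 1/2) (epart m + ppart m)
     * pochhammer (- real (ppart M) * (\<rho>1 + \<rho>2 + r1 + r2) + \<rho>1 + \<rho>2 + 1) (epart m)"

definition weight_w ::
  "nat \<Rightarrow> (nat \<Rightarrow> nat) \<Rightarrow> (nat \<Rightarrow> nat) \<Rightarrow> (nat \<Rightarrow> real) \<Rightarrow> real \<Rightarrow> real" where
  "weight_w i l n \<alpha> \<beta> =
     (if l i < psum n (i - 1) then 0
      else BI_w (rho1 \<alpha> n i) (rho2 \<alpha> n i (int (l (i + 1)))) (rr1 \<alpha> n i (int (l (i + 1))))
             (rr2 \<alpha> \<beta> n i) (l i - psum n (i - 1)))"

definition norm_h ::
  "nat \<Rightarrow> (nat \<Rightarrow> nat) \<Rightarrow> (nat \<Rightarrow> nat) \<Rightarrow> (nat \<Rightarrow> real) \<Rightarrow> real \<Rightarrow> real" where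
  "norm_h i l n \<alpha> \<beta> =
     BI_h (rho1 \<alpha> n i) (rho2 \<alpha> n i (int (l (i + 1)))) (rr1 \<alpha> n i (int (l (i + 1))))
       (rr2 \<alpha> \<beta> n i) (l (i + 1) - psum n (i - 1)) (n i)"

definition Omega ::
  "nat \<Rightarrow> (nat \<Rightarrow> nat) \<Rightarrow> (nat \<Rightarrow> nat) \<Rightarrow> (nat \<Rightarrow> real) \<Rightarrow> real \<Rightarrow> nat \<Rightarrow> real" where
  "Omega s l n \<alpha> \<beta> N =
     (let l' = l(s + 1 := N) in
      if \<exists>i\<in>{1..s}. l' i < psum n (i - 1) then 0
      else (\<Prod>i=1..s. weight_w i l' n \<alpha> \<beta>) / (\<Prod>i=1..s-1. norm_h i l' n \<alpha> \<beta>))"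

text \<open>\<open>h\<^sup>(\<^sup>s\<^sup>)\<close> depends on the grid point only through its entry
  \<open>l\<^sub>s\<^sub>+\<^sub>1 = N\<close>, so a constant function can be passed.\<close>

definition HH :: "nat \<Rightarrow> (nat \<Rightarrow> nat) \<Rightarrow> (nat \<Rightarrow> real) \<Rightarrow> real \<Rightarrow> nat \<Rightarrow> real" where
  "HH s n \<alpha> \<beta> N = norm_h s (\<lambda>_. N) n \<alpha> \<beta>"


subsection \<open>Iterated sums\<close>

text \<open>
  \<open>iter_sum k F l\<close> is the iterated sum of \<open>F\<close> over \<open>l\<^sub>k\<close> from 0 to
  \<open>l\<^sub>k\<^sub>+\<^sub>1\<close> (outermost), down to \<open>l\<^sub>1\<close> from 0 to \<open>l\<^sub>2\<close> (innermost);
  the entries of \<open>l\<close> with index above k are kept.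
\<close>

primrec iter_sum :: "nat \<Rightarrow> ((nat \<Rightarrow> nat) \<Rightarrow> real) \<Rightarrow> (nat \<Rightarrow> nat) \<Rightarrow> real" where
  "iter_sum 0 F l = F l"
| "iter_sum (Suc k) F l = (\<Sum>j=0..l (k + 2). iter_sum k F (l(k + 1 := j)))"

end

theory Submission
  imports Defs
begin

text \<open>
  The grid \<open>\<rho>\<^sub>1, -\<rho>\<^sub>1-1, \<rho>\<^sub>1+1, -\<rho>\<^sub>1-2, \<dots>\<close> is the orbit of \<open>\<rho>\<^sub>1\<close> under the reflections
  \<open>x \<mapsto> -x\<close> and \<open>x \<mapsto> -1-x\<close>. The difference operator built from these two reflections acts
  bidiagonally on the Newton basis of the grid, and its eigenvalues form, up to a shift, a grid of the
  same kind. Hence the kernel pairing the Newton basis of the grid with that of the eigenvalues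
  is an eigenfunction in both variables: one equation is the three-term recurrence of the
  Bannai--Ito polynomials, the other one is an eigenvalue equation for an operator that is
  symmetric with respect to the weights. This gives orthogonality, and the recurrence gives
  \<open>h\<^sub>n\<^sub>+\<^sub>1 = A\<^sub>n C\<^sub>n\<^sub>+\<^sub>1 h\<^sub>n\<close>. The total mass \<open>h\<^sub>0\<close> follows because symmetry makes the moments of successive
  Newton polynomials proportional, and the last one has a single nonzero term.
  In the multivariate sum, the innermost summation produces a norm \<open>h\<close> that cancels
  against the denominator of \<open>\<Omega>\<close>, and forces \<open>n\<^sub>i = m\<^sub>i\<close>, so that the next
  summation is again a univariate one.
\<close>

subsection \<open>The reflection operator on the Newton basis\<close>

text \<open>Two starting values occur: \<open>\<tau> = \<rho>1\<close> gives the grid of the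
  orthogonality sum, and \<open>\<tau> = \<kappa> / 2\<close> the eigenvalues shifted by
  \<open>\<kappa> / 2\<close>.\<close>

definition node :: "real \<Rightarrow> nat \<Rightarrow> real" where
  "node \<tau> k = (if even k then \<tau> + real k / 2 else - (\<tau> + (real k + 1) / 2))"

definition newton :: "real \<Rightarrow> nat \<Rightarrow> real \<Rightarrow> real" where
  "newton \<tau> k t = (\<Prod>j<k. t - node \<tau> j)"

lemma newton_0 [simp]: "newton \<tau> 0 t = 1"
  by (simp add: newton_def)

lemma newton_Suc [simp]: "newton \<tau> (Suc k) t = newton \<tau> k t * (t - node \<tau> k)"
  by (simp add: newton_def)

lemma newton_node_eq_0: "j < k \<Longrightarrow> newton \<tau> k (node \<tau> j) = 0"
  unfolding newton_def by (rule prod_zero) auto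

lemma node_even [simp]: "node \<tau> (2 * e) = \<tau> + real e"
  by (simp add: node_def)

lemma node_0 [simp]: "node \<tau> 0 = \<tau>"
  by (simp add: node_def)

lemma node_odd [simp]: "node \<tau> (Suc (2 * e)) = - (\<tau> + real e + 1)"
  by (simp add: node_def field_simps)

text \<open>Each reflection moves a node to a neighbour, and the directions alternate with parity.
  This turns an operator built from reflections into a tridiagonal one. The first node has no
  predecessor, whence \<open>0 < k\<close>.\<close>

lemma node_reflect_even:
  assumes "even k"
  shows "- 1 - node \<tau> k = node \<tau> (Suc k)" and "0 < k \<Longrightarrow> - node \<tau> k = node \<tau> (k - 1)"
proof -
  obtain e where k: "k = 2 * e" using assms by (elim evenE)
  show "- 1 - node \<tau> k = node \<tau> (Suc k)" by (simp add: k)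
  show "- node \<tau> k = node \<tau> (k - 1)" if "0 < k"
  proof -
    have "k - 1 = Suc (2 * (e - 1))" "real (e - 1) = real e - 1" using k that by auto
    then show ?thesis by (simp add: k del: One_nat_def)
  qed
qed

lemma node_reflect_odd:
  assumes "odd k"
  shows "- node \<tau> k = node \<tau> (Suc k)" and "- 1 - node \<tau> k = node \<tau> (k - 1)"
proof -
  obtain e where k: "k = Suc (2 * e)" using assms by (auto elim: oddE)
  have "Suc k = 2 * Suc e" by (simp add: k)
  then show "- node \<tau> k = node \<tau> (Suc k)" by (simp only: node_even) (simp add: k)
  show "- 1 - node \<tau> k = node \<tau> (k - 1)" by (simp add: k)
qed

text \<open>The reflection about -1/2 exchanges the nodes with indices \<open>2 * b\<close> and
  \<open>2 * b + 1\<close>.\<close>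

lemma newton_even_reflect: "newton \<tau> (2 * e) (- 1 - t) = newton \<tau> (2 * e) t"
proof (induction e)
  case (Suc e)
  have step: "newton \<tau> (2 * Suc e) u = newton \<tau> (2 * e) u * ((u - \<tau> - real e) * (u + \<tau> + real e + 1))" for u
    by (simp add: diff_diff_eq add.assoc)
  show ?case
    unfolding step Suc.IH by (simp add: algebra_simps)
qed simp

text \<open>After the first node, the nodes with indices \<open>2 * b + 1\<close> and
  \<open>2 * b + 2\<close> are negatives of each other, so all but one linear factor combine to an
  even function of \<open>t\<close>.\<close>

lemma newton_odd_factor:
  "newton \<tau> (Suc (2 * e)) t = (t - \<tau>) * (\<Prod>b<e. t\<^sup>2 - (\<tau> + 1 + real b)\<^sup>2)"
proof (induction e)
  case (Suc e)
  have "newton \<tau> (Suc (2 * Suc e)) t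
      = newton \<tau> (Suc (2 * e)) t * ((t - node \<tau> (Suc (2 * e))) * (t - node \<tau> (2 * Suc e)))"
    by simp
  also have "(t - node \<tau> (Suc (2 * e))) * (t - node \<tau> (2 * Suc e)) = t\<^sup>2 - (\<tau> + 1 + real e)\<^sup>2"
    by (simp only: node_even node_odd) (simp add: algebra_simps power2_eq_square)
  finally show ?case
    by (simp only: Suc.IH) (simp add: mult.assoc)
qed simp

text \<open>The parameters correspond to \<open>a = \<rho>\<^sub>2\<close>, \<open>b = r\<^sub>1 - 1/2\<close>, \<open>c = r\<^sub>2 - 1/2\<close>.\<close>

definition reflF :: "real \<Rightarrow> real \<Rightarrow> real \<Rightarrow> real" where
  "reflF \<tau> a t = (t - \<tau>) * (t - a) / (2 * t)"

definition reflG :: "real \<Rightarrow> real \<Rightarrow> real \<Rightarrow> real" where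
  "reflG b c t = (t - b) * (t - c) / (2 * t + 1)"

definition eig :: "real \<Rightarrow> real \<Rightarrow> real \<Rightarrow> real \<Rightarrow> nat \<Rightarrow> real" where
  "eig \<tau> a b c k = (if even k then real k / 2 else b + c - a - \<tau> - (real k - 1) / 2)"

definition low :: "real \<Rightarrow> real \<Rightarrow> real \<Rightarrow> real \<Rightarrow> nat \<Rightarrow> real" where
  "low \<tau> a b c k =
     (if even k then - (real k / 2) * (\<tau> + real k / 2 + a)
      else - (\<tau> + (real k - 1) / 2 - b) * (\<tau> + (real k - 1) / 2 - c))"

text \<open>The left side is the Dunkl-type shift operator of the Bannai--Ito polynomials. Each
  reflection difference is divisible by the denominator of its coefficient, and the two symmetries
  above keep the result within two neighbouring basis elements.\<close>

lemma refl_operator_newton: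
  assumes "t \<noteq> 0" "2 * t + 1 \<noteq> 0"
  shows "reflF \<tau> a t * (newton \<tau> k t - newton \<tau> k (- t))
           + reflG b c t * (newton \<tau> k (- 1 - t) - newton \<tau> k t)
         = eig \<tau> a b c k * newton \<tau> k t + low \<tau> a b c k * newton \<tau> (k - 1) t"
proof -
  have F: "reflF \<tau> a t * (2 * t * y) = (t - \<tau>) * (t - a) * y" for y
    using assms by (simp add: reflF_def)
  have G: "reflG b c t * (- (2 * t + 1) * y) = - ((t - b) * (t - c) * y)" for y
    using assms by (simp add: reflG_def field_simps)
  show ?thesis
  proof (cases "even k")
    case True
    then obtain e where k: "k = 2 * e" by (elim evenE)
    show ?thesis
    proof (cases e)
      case 0
      then show ?thesis by (simp add: k eig_def low_def)
    next
      case (Suc f)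
      define E where "E = (\<Prod>b<f. t\<^sup>2 - (\<tau> + 1 + real b)\<^sup>2)"
      have k': "k = Suc (Suc (2 * f))" by (simp add: k Suc)
      have p: "newton \<tau> k u = newton \<tau> (Suc (2 * f)) u * (u + \<tau> + real f + 1)" for u
        by (simp add: k' add_ac)
      have 1: "newton \<tau> k t = (t - \<tau>) * E * (t + \<tau> + real f + 1)"
        by (simp only: p newton_odd_factor E_def)
      have 2: "newton \<tau> k (- t) = (- t - \<tau>) * E * (- t + \<tau> + real f + 1)"
        by (simp only: p newton_odd_factor E_def) simp
      have 3: "newton \<tau> (k - 1) t = (t - \<tau>) * E"
        using newton_odd_factor[of \<tau> f t] by (simp add: k' E_def)
      have 4: "newton \<tau> k (- 1 - t) = newton \<tau> k t"
        unfolding k by (rule newton_even_reflect)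
      have "newton \<tau> k t - newton \<tau> k (- t) = 2 * t * ((real f + 1) * E)"
        unfolding 1 2 by (simp add: algebra_simps)
      then have "reflF \<tau> a t * (newton \<tau> k t - newton \<tau> k (- t)) = (t - \<tau>) * (t - a) * ((real f + 1) * E)"
        by (simp only: F)
      then show ?thesis
        by (simp only: 4 3 1) (simp add: k' eig_def low_def field_simps)
    qed
  next
    case False
    then obtain e where k: "k = Suc (2 * e)" by (auto elim: oddE)
    define E where "E = (\<Prod>b<e. t\<^sup>2 - (\<tau> + 1 + real b)\<^sup>2)"
    define S where "S = newton \<tau> (2 * e) t"
    have 1: "newton \<tau> k t = (t - \<tau>) * E"
      by (simp only: k newton_odd_factor E_def)
    have 2: "newton \<tau> k (- t) = (- t - \<tau>) * E"
      by (simp only: k newton_odd_factor E_def) simp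
    have 3: "newton \<tau> k t = S * (t - \<tau> - real e)"
      by (simp add: k S_def diff_diff_eq)
    have 4: "newton \<tau> k (- 1 - t) = S * (- 1 - t - \<tau> - real e)"
      by (simp add: k S_def newton_even_reflect diff_diff_eq)
    have 5: "newton \<tau> (k - 1) t = S" by (simp add: k S_def)
    have "newton \<tau> k t - newton \<tau> k (- t) = 2 * t * E"
      unfolding 1 2 by (simp add: algebra_simps)
    then have 6: "reflF \<tau> a t * (newton \<tau> k t - newton \<tau> k (- t)) = (t - a) * newton \<tau> k t"
      by (simp only: F 1) simp
    have "newton \<tau> k (- 1 - t) - newton \<tau> k t = - (2 * t + 1) * S"
      unfolding 3 4 by (simp add: algebra_simps)
    then have 7: "reflG b c t * (newton \<tau> k (- 1 - t) - newton \<tau> k t) = - ((t - b) * (t - c) * S)"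
      by (simp only: G)
    have e: "eig \<tau> a b c k = b + c - a - \<tau> - real e"
      "low \<tau> a b c k = - (\<tau> + real e - b) * (\<tau> + real e - c)"
      by (simp_all add: k eig_def low_def)
    \<comment> \<open>The quadratic terms cancel. The slope of the remaining linear factor is
      \<open>eig\<close>, and its value at \<open>t = \<tau> + real e\<close> is
      \<open>low\<close>.\<close>
    have "(t - a) * (S * (t - \<tau> - real e)) + - ((t - b) * (t - c) * S)
       = eig \<tau> a b c k * (S * (t - \<tau> - real e)) + low \<tau> a b c k * S"
      unfolding e by algebra
    then show ?thesis
      unfolding 6 7 unfolding 5 unfolding 3 .
  qed
qed

section \<open>The operator on grid functions\<close>

definition up :: "real \<Rightarrow> real \<Rightarrow> real \<Rightarrow> real \<Rightarrow> nat \<Rightarrow> real" where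
  "up \<tau> a b c i = (if even i then reflG b c (node \<tau> i) else - reflF \<tau> a (node \<tau> i))"

definition down :: "real \<Rightarrow> real \<Rightarrow> real \<Rightarrow> real \<Rightarrow> nat \<Rightarrow> real" where
  "down \<tau> a b c i = (if even i then - reflF \<tau> a (node \<tau> i) else reflG b c (node \<tau> i))"

text \<open>The factor \<open>t - \<tau>\<close> of \<open>reflF\<close> vanishes at the first node,
  so the truncated index \<open>i - 1\<close> at \<open>i = 0\<close> contributes nothing.\<close>

lemma down_0 [simp]: "down \<tau> a b c 0 = 0"
  by (simp add: down_def reflF_def node_def)

text \<open>Positivity of \<open>\<tau>\<close> keeps the nodes away from the poles 0 and -1/2 of
  the coefficients; the reflected nodes are then neighbours on the grid.\<close>

lemma up_down_newton:
  assumes "\<tau> > 0"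
  shows "up \<tau> a b c i * (newton \<tau> k (node \<tau> (Suc i)) - newton \<tau> k (node \<tau> i))
           + down \<tau> a b c i * (newton \<tau> k (node \<tau> (i - 1)) - newton \<tau> k (node \<tau> i))
         = eig \<tau> a b c k * newton \<tau> k (node \<tau> i) + low \<tau> a b c k * newton \<tau> (k - 1) (node \<tau> i)"
proof -
  have ne: "node \<tau> i \<noteq> 0" "2 * node \<tau> i + 1 \<noteq> 0"
    using assms by (auto simp: node_def field_simps add_eq_0_iff elim!: oddE)
  note R = refl_operator_newton[OF ne, of \<tau> a k b c]
  show ?thesis
  proof (cases "even i")
    case True
    show ?thesis
    proof (cases "i = 0")
      case True
      have "reflF \<tau> a (node \<tau> 0) = 0" by (simp add: reflF_def node_def)
      then show ?thesis
        using R node_reflect_even(1)[OF \<open>even i\<close>, of \<tau>] True by (simp add: up_def)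
    next
      case False
      then show ?thesis
        using R node_reflect_even[OF \<open>even i\<close>, of \<tau>] True by (simp add: up_def down_def algebra_simps)
    qed
  next
    case False
    then show ?thesis
      using R node_reflect_odd[OF False, of \<tau>] by (simp add: up_def down_def algebra_simps)
  qed
qed

section \<open>Bidiagonal expansions and summation by parts\<close>

text \<open>Division by the products of \<open>\<mu>\<close> makes the lower term of index
  \<open>k\<close> meet the diagonal term of index \<open>k - 1\<close>, and the recurrence of
  \<open>g\<close> changes their sum into \<open>l\<close> times the summand. The abstract form
  serves both variables of the kernel.\<close>

lemma bidiagonal_expansion:
  fixes F0 F1 F2 g e \<mu> :: "nat \<Rightarrow> real"
  assumes op: "\<And>k. u * (F1 k - F0 k) + d * (F2 k - F0 k) = e k * F0 k + \<mu> k * F0 (k - 1)"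
    and g: "\<And>k. g (Suc k) = (l - e k) * g k"
    and "\<mu> 0 = 0" and \<mu>: "\<And>k. 1 \<le> k \<Longrightarrow> k \<le> M \<Longrightarrow> \<mu> k \<noteq> 0"
    and top: "F0 M * g (Suc M) = 0"
    and S_def: "\<And>F. S F = (\<Sum>k\<le>M. F k * g k / (\<Prod>i=1..k. \<mu> i))"
  shows "u * (S F1 - S F0) + d * (S F2 - S F0) = l * S F0"
proof -
  let ?\<pi> = "\<lambda>k. \<Prod>i=1..k. \<mu> i"
  \<comment> \<open>Partial sums satisfy the equation up to one boundary term, which
    \<open>top\<close> removes at \<open>K = M\<close>.\<close>
  have part: "(\<Sum>k\<le>K. (e k * F0 k + \<mu> k * F0 (k - 1)) * g k / ?\<pi> k)
      = l * (\<Sum>k\<le>K. F0 k * g k / ?\<pi> k) - F0 K * g (Suc K) / ?\<pi> K" if "K \<le> M" for K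
    using that
  proof (induction K)
    case 0
    then show ?case by (simp add: \<open>\<mu> 0 = 0\<close> g algebra_simps)
  next
    case (Suc K)
    have "\<mu> (Suc K) \<noteq> 0" using \<mu> Suc.prems by simp
    then have "(e (Suc K) * F0 (Suc K) + \<mu> (Suc K) * F0 K) * g (Suc K) / ?\<pi> (Suc K)
      = e (Suc K) * F0 (Suc K) * g (Suc K) / ?\<pi> (Suc K) + F0 K * g (Suc K) / ?\<pi> K"
      by (simp add: add_divide_distrib distrib_right)
    moreover have "F0 (Suc K) * g (Suc (Suc K)) / ?\<pi> (Suc K)
      = l * (F0 (Suc K) * g (Suc K) / ?\<pi> (Suc K)) - e (Suc K) * F0 (Suc K) * g (Suc K) / ?\<pi> (Suc K)"
      by (simp only: g[of "Suc K"]) (simp add: algebra_simps diff_divide_distrib)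
    ultimately show ?case
      using Suc by (simp add: distrib_left)
  qed
  have "u * (S F1 - S F0) + d * (S F2 - S F0)
      = (\<Sum>k\<le>M. (u * (F1 k - F0 k) + d * (F2 k - F0 k)) * g k / ?\<pi> k)"
    unfolding S_def sum_subtractf[symmetric] sum_distrib_left sum.distrib[symmetric]
    by (intro sum.cong) (auto simp: algebra_simps add_divide_distrib diff_divide_distrib)
  also have "\<dots> = l * S F0"
    using part[of M] top by (simp add: op S_def)
  finally show ?thesis .
qed

text \<open>The first hypothesis is detailed balance. The sum that remains is symmetric in
  \<open>f\<close> and \<open>g\<close>, so only the boundary term obstructs
  self-adjointness.\<close>

lemma summation_by_parts_tridiagonal:
  fixes w a c f g :: "nat \<Rightarrow> real"
  assumes "\<And>k. k < K \<Longrightarrow> w k * a k = w (Suc k) * c (Suc k)" and "c 0 = 0"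
  shows "(\<Sum>k\<le>K. w k * (a k * (f (Suc k) - f k) + c k * (f (k - 1) - f k)) * g k)
     = w K * a K * (f (Suc K) - f K) * g K
       - (\<Sum>k<K. w k * a k * (f (Suc k) - f k) * (g (Suc k) - g k))"
  using assms
proof (induction K)
  case (Suc K)
  have "w (Suc K) * (c (Suc K) * (f K - f (Suc K))) * g (Suc K)
     = w K * a K * (f K - f (Suc K)) * g (Suc K)"
    using Suc.prems(1)[of K] by simp
  moreover have "w (Suc K) * c (Suc K) = w K * a K"
    using Suc.prems(1)[of K] by simp
  moreover note Suc.IH[OF Suc.prems(1)[OF less_SucI] Suc.prems(2)]
  ultimately show ?case
    unfolding sum.atMost_Suc sum.lessThan_Suc diff_Suc_1 by algebra
qed simp

subsection \<open>Parameters, weights and duality\<close>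

lemma quarter:
  fixes u v d :: real
  shows "2 * u * (2 * v) / (4 * d) = u * v / d" and "- 2 * u * (- 2 * v) / (- 4 * d) = - (u * v / d)"
  by simp_all

text \<open>Bispectral duality: the recurrence in the degree is the same reflection operator on the
  grid that starts at \<open>\<kappa> / 2\<close>, with dual parameters. Each numerator factor is,
  up to sign, twice the difference between a node and a parameter.\<close>

lemma BI_A_eq_up:
  assumes "\<kappa> = \<rho>1 + \<rho>2 - r1 - r2"
  shows "BI_A \<rho>1 \<rho>2 r1 r2 n
    = up (\<kappa> / 2) (\<rho>1 + \<rho>2 - \<kappa> / 2) (\<kappa> / 2 - \<rho>1 + (r1 - 1/2)) (\<kappa> / 2 - \<rho>1 + (r2 - 1/2)) n"
proof (cases "even n")
  case True
  then obtain e where n: "n = 2 * e" by (elim evenE)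
  let ?t = "\<kappa> / 2 + real e"
  have 1: "real n + 2*\<rho>1 - 2*r1 + real (ppart n) * (2*\<rho>2 - 2*r2) + 1 = 2 * (?t - (\<kappa> / 2 - \<rho>1 + (r1 - 1/2)))"
    by (simp add: n assms field_simps)
  have 2: "real n + 2*\<rho>1 - 2*r2 + real (ppart n) * (2*r2 + 2*\<rho>2) + 1 = 2 * (?t - (\<kappa> / 2 - \<rho>1 + (r2 - 1/2)))"
    by (simp add: n assms field_simps)
  have 3: "4 * (real n + \<rho>1 + \<rho>2 - r1 - r2 + 1) = 4 * (2 * ?t + 1)"
    by (simp add: n assms field_simps)
  show ?thesis
    unfolding BI_A_def 1 2 3 quarter by (simp only: n up_def reflG_def node_even dvd_triv_left if_True)
next
  case False
  then obtain e where n: "n = Suc (2 * e)" by (auto elim: oddE)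
  have pp: "real (ppart n) = 1" by (simp add: n)
  let ?t = "- (\<kappa> / 2 + real e + 1)"
  have 1: "real n + 2*\<rho>1 - 2*r1 + real (ppart n) * (2*\<rho>2 - 2*r2) + 1 = - 2 * (?t - \<kappa> / 2)"
    by (simp add: pp) (simp add: n assms field_simps)
  have 2: "real n + 2*\<rho>1 - 2*r2 + real (ppart n) * (2*r2 + 2*\<rho>2) + 1 = - 2 * (?t - (\<rho>1 + \<rho>2 - \<kappa> / 2))"
    by (simp add: pp) (simp add: n assms field_simps)
  have 3: "4 * (real n + \<rho>1 + \<rho>2 - r1 - r2 + 1) = - 4 * (2 * ?t)"
    by (simp add: pp) (simp add: n assms field_simps)
  show ?thesis
    unfolding BI_A_def 1 2 3 quarter by (simp only: n up_def reflF_def node_odd even_Suc dvd_triv_left if_False simp_thms)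
qed

lemma BI_C_eq_down:
  assumes "\<kappa> = \<rho>1 + \<rho>2 - r1 - r2"
  shows "BI_C \<rho>1 \<rho>2 r1 r2 n
    = down (\<kappa> / 2) (\<rho>1 + \<rho>2 - \<kappa> / 2) (\<kappa> / 2 - \<rho>1 + (r1 - 1/2)) (\<kappa> / 2 - \<rho>1 + (r2 - 1/2)) n"
proof (cases "even n")
  case True
  then obtain e where n: "n = 2 * e" by (elim evenE)
  let ?t = "\<kappa> / 2 + real e"
  have 1: "real n + real (ppart n) * (2*\<rho>2 - 2*r2) = 2 * (?t - \<kappa> / 2)"
    by (simp add: n assms field_simps)
  have 2: "real n - 2*r1 - 2*r2 + real (ppart n) * (2*r2 + 2*\<rho>2) = 2 * (?t - (\<rho>1 + \<rho>2 - \<kappa> / 2))"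
    by (simp add: n assms field_simps)
  have 3: "4 * (real n + \<rho>1 + \<rho>2 - r1 - r2) = 4 * (2 * ?t)"
    by (simp add: n assms field_simps)
  show ?thesis
    unfolding BI_C_def 1 2 3 quarter by (simp only: n down_def reflF_def node_even dvd_triv_left if_True)
next
  case False
  then obtain e where n: "n = Suc (2 * e)" by (auto elim: oddE)
  have pp: "real (ppart n) = 1" by (simp add: n)
  let ?t = "- (\<kappa> / 2 + real e + 1)"
  have 1: "real n + real (ppart n) * (2*\<rho>2 - 2*r2) = - 2 * (?t - (\<kappa> / 2 - \<rho>1 + (r1 - 1/2)))"
    by (simp add: pp) (simp add: n assms field_simps)
  have 2: "real n - 2*r1 - 2*r2 + real (ppart n) * (2*r2 + 2*\<rho>2) = - 2 * (?t - (\<kappa> / 2 - \<rho>1 + (r2 - 1/2)))"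
    by (simp add: pp) (simp add: n assms field_simps)
  have 3: "4 * (real n + \<rho>1 + \<rho>2 - r1 - r2) = - 4 * (2 * ?t + 1)"
    by (simp add: pp) (simp add: n assms field_simps)
  show ?thesis
    unfolding BI_C_def 1 2 3 quarter
    by (simp only: n down_def reflG_def node_odd even_Suc dvd_triv_left if_False simp_thms minus_minus)
qed

text \<open>The eigenvalues of either grid are the nodes of the other one, shifted to start at 0;
  \<open>eig_node\<close> is the counterpart.\<close>

lemma eig_dual:
  assumes "\<kappa> = \<rho>1 + \<rho>2 - r1 - r2"
  shows "eig (\<kappa> / 2) (\<rho>1 + \<rho>2 - \<kappa> / 2) (\<kappa> / 2 - \<rho>1 + (r1 - 1/2)) (\<kappa> / 2 - \<rho>1 + (r2 - 1/2)) k
    = node \<rho>1 k - \<rho>1"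
  using assms by (simp add: eig_def node_def field_simps)

lemma eig_node:
  assumes "\<kappa> = \<rho>1 + \<rho>2 - r1 - r2"
  shows "eig \<rho>1 \<rho>2 (r1 - 1/2) (r2 - 1/2) k = node (\<kappa> / 2) k - \<kappa> / 2"
  using assms by (simp add: eig_def node_def field_simps)

text \<open>Both grids share their lower coefficients, so a single kernel with denominators built
  from \<open>low\<close> serves for both variables.\<close>

lemma low_dual:
  "low (\<kappa> / 2) (\<rho>1 + \<rho>2 - \<kappa> / 2) (\<kappa> / 2 - \<rho>1 + (r1 - 1/2)) (\<kappa> / 2 - \<rho>1 + (r2 - 1/2)) k
    = low \<rho>1 \<rho>2 (r1 - 1/2) (r2 - 1/2) k"
  by (simp add: low_def algebra_simps)

section \<open>Closed forms for weights and Newton moments\<close>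

lemma BI_w_Suc_even:
  "BI_w \<rho>1 \<rho>2 r1 r2 (Suc (2 * e)) = - BI_w \<rho>1 \<rho>2 r1 r2 (2 * e)
     * ((\<rho>1 - r1 + 1/2 + real e) * (\<rho>1 - r2 + 1/2 + real e)
        / ((\<rho>1 + r2 + 1/2 + real e) * (\<rho>1 + r1 + 1/2 + real e)))"
  by (simp add: BI_w_def pochhammer_Suc) (simp add: mult_ac)

lemma BI_w_Suc_odd:
  "BI_w \<rho>1 \<rho>2 r1 r2 (Suc (Suc (2 * e))) = - BI_w \<rho>1 \<rho>2 r1 r2 (Suc (2 * e))
     * ((\<rho>1 + \<rho>2 + 1 + real e) * (2 * \<rho>1 + 1 + real e)
        / (real (Suc e) * (\<rho>1 - \<rho>2 + 1 + real e)))"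
  by (simp add: BI_w_def pochhammer_Suc del: of_nat_Suc) (simp add: mult_ac del: of_nat_Suc)

lemma newton_even_pochhammer:
  "newton \<tau> (2 * e) t = (-1) ^ e * pochhammer (\<tau> - t) e * pochhammer (\<tau> + t + 1) e"
proof (induction e)
  case (Suc e)
  have "newton \<tau> (2 * Suc e) t = newton \<tau> (2 * e) t * ((t - \<tau> - real e) * (t + \<tau> + real e + 1))"
    by (simp add: diff_diff_eq add.assoc)
  then show ?case unfolding Suc.IH
    by (simp add: pochhammer_Suc algebra_simps)
qed simp

text \<open>This evaluates the single nonzero term of the last Newton moment.\<close>

lemma newton_diagonal:
  "newton \<tau> k (node \<tau> k)
     = (-1) ^ ppart k * fact (epart k) * pochhammer (2 * \<tau> + 1 + real (epart k)) (epart k + ppart k)"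
proof -
  have even: "newton \<tau> (2 * e) (\<tau> + real e) = fact e * pochhammer (2 * \<tau> + 1 + real e) e" for e
    using pochhammer_same[of e, where ?'a = real]
    by (simp add: newton_even_pochhammer add_ac flip: power_mult_distrib)
  show ?thesis
  proof (cases "even k")
    case True
    then obtain e where "k = 2 * e" by (elim evenE)
    then show ?thesis by (simp add: even)
  next
    case False
    then obtain e where k: "k = Suc (2 * e)" by (auto elim: oddE)
    \<comment> \<open>The odd node is the image of \<open>\<tau> + real e\<close> under the
      reflection that leaves this polynomial invariant, so the even case applies with one extra
      factor.\<close>
    have "newton \<tau> (2 * e) (- (\<tau> + real e + 1)) = newton \<tau> (2 * e) (\<tau> + real e)"
      using newton_even_reflect[of \<tau> e "\<tau> + real e"] by (simp add: algebra_simps)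
    then have "newton \<tau> k (node \<tau> k) = newton \<tau> (2 * e) (\<tau> + real e) * - (2 * \<tau> + 1 + real e + real e)"
      by (simp add: k)
    then have "newton \<tau> k (node \<tau> k)
      = - (fact e * pochhammer (2 * \<tau> + 1 + real e) e * (2 * \<tau> + 1 + real e + real e))"
      unfolding even by (simp only: mult_minus_right)
    then show ?thesis
      by (simp only:) (simp add: k pochhammer_Suc)
  qed
qed

text \<open>Each Newton moment is \<open>- eig / low\<close> times the next one, so this product
  links the first moment to the last. Odd indices supply the sign; at even indices the eigenvalue
  cancels against a factor of \<open>low\<close>.\<close>

lemma prod_eig_low:
  assumes "\<kappa> = \<rho>1 + \<rho>2 - r1 - r2"
  shows "(\<Prod>i=1..k. - eig \<rho>1 \<rho>2 (r1 - 1/2) (r2 - 1/2) i / low \<rho>1 \<rho>2 (r1 - 1/2) (r2 - 1/2) i)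
    = (-1) ^ (epart k + ppart k) * pochhammer (\<kappa> + 1) (epart k + ppart k)
      / (pochhammer (\<rho>1 + \<rho>2 + 1) (epart k) * pochhammer (\<rho>1 - r1 + 1/2) (epart k + ppart k)
         * pochhammer (\<rho>1 - r2 + 1/2) (epart k + ppart k))"
    (is "prod ?f _ = ?R k")
proof -
  have odd: "?f (Suc (2 * e)) = - ((\<kappa> + 1 + real e) / ((\<rho>1 - r1 + 1/2 + real e) * (\<rho>1 - r2 + 1/2 + real e)))" for e
  proof -
    have "eig \<rho>1 \<rho>2 (r1 - 1/2) (r2 - 1/2) (Suc (2 * e)) = - (\<kappa> + 1 + real e)"
      by (simp add: eig_def assms)
    moreover have "low \<rho>1 \<rho>2 (r1 - 1/2) (r2 - 1/2) (Suc (2 * e))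
      = - ((\<rho>1 - r1 + 1/2 + real e) * (\<rho>1 - r2 + 1/2 + real e))"
      by (simp add: low_def algebra_simps)
    ultimately show ?thesis
      by (simp only: minus_minus divide_minus_left divide_minus_right)
  qed
  have even: "?f (Suc (Suc (2 * e))) = 1 / (\<rho>1 + \<rho>2 + 1 + real e)" for e
  proof -
    have "eig \<rho>1 \<rho>2 (r1 - 1/2) (r2 - 1/2) (Suc (Suc (2 * e))) = real (Suc e)"
      by (simp add: eig_def)
    moreover have "low \<rho>1 \<rho>2 (r1 - 1/2) (r2 - 1/2) (Suc (Suc (2 * e)))
      = - (real (Suc e) * (\<rho>1 + \<rho>2 + 1 + real e))"
      by (simp add: low_def field_simps)
    ultimately show ?thesis by (simp del: of_nat_Suc)
  qed
  have R_odd: "?R (2 * e) * ?f (Suc (2 * e)) = ?R (Suc (2 * e))" for e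
    unfolding odd by (simp add: pochhammer_Suc) (simp add: mult_ac)
  have R_even: "?R (Suc (2 * e)) * ?f (Suc (Suc (2 * e))) = ?R (Suc (Suc (2 * e)))" for e
    unfolding even by (simp add: pochhammer_Suc)
  have ev: "prod ?f {1..2 * e} = ?R (2 * e)" for e
  proof (induction e)
    case (Suc e)
    have "prod ?f {1..2 * Suc e} = prod ?f {1..2 * e} * ?f (Suc (2 * e)) * ?f (Suc (Suc (2 * e)))"
      by (simp del: One_nat_def)
    then show ?case unfolding Suc R_odd R_even by simp
  qed simp
  show ?thesis
  proof (cases "even k")
    case True
    then obtain e where k: "k = 2 * e" by (elim evenE)
    show ?thesis unfolding k by (rule ev)
  next
    case False
    then obtain e where k: "k = Suc (2 * e)" by (auto elim: oddE)
    have "prod ?f {1..k} = prod ?f {1..2 * e} * ?f (Suc (2 * e))"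
      unfolding k by (subst prod.nat_ivl_Suc') (simp, rule mult.commute)
    also have "\<dots> = ?R k" unfolding ev R_odd k ..
    finally show ?thesis .
  qed
qed

subsection \<open>Univariate orthogonality\<close>

text \<open>Here \<open>p\<close> and \<open>q\<close> stand for \<rho>1 and r2, and
  \<open>g\<close> is the gap between \<open>\<rho>2\<close> and \<open>r1\<close>. The truncation
  hypotheses make the recurrence coefficient A vanish at \<open>M\<close>, through its first
  numerator factor for even \<open>M\<close> and its second for odd \<open>M\<close>.\<close>

locale bannai_ito_grid =
  fixes p \<rho>2 r1 q g :: real and M :: nat
  assumes p_pos: "p > 0" and g_pos: "g > 0" and pmq: "p - q > 0" and ppq: "p + q + 1/2 > 0"
    and trunc_even: "even M \<Longrightarrow> \<rho>2 = real M / 2 + p + g + 1/2 \<and> r1 = real M / 2 + p + 1/2"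
    and trunc_odd: "odd M \<Longrightarrow> \<rho>2 = - (real M / 2 + p + 1/2) \<and> r1 = - (real M / 2 + p + g + 1/2)"
begin

abbreviation "\<kappa> \<equiv> p + \<rho>2 - r1 - q"
abbreviation "lam \<equiv> eig p \<rho>2 (r1 - 1/2) (q - 1/2)"
abbreviation "lw \<equiv> low p \<rho>2 (r1 - 1/2) (q - 1/2)"
abbreviation "upg \<equiv> up p \<rho>2 (r1 - 1/2) (q - 1/2)"
abbreviation "dwg \<equiv> down p \<rho>2 (r1 - 1/2) (q - 1/2)"
abbreviation "wt \<equiv> BI_w p \<rho>2 r1 q"
abbreviation "A \<equiv> BI_A p \<rho>2 r1 q"
abbreviation "C \<equiv> BI_C p \<rho>2 r1 q"

lemma rho2_diff: "\<rho>2 = r1 + g"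
  using trunc_even trunc_odd by (cases "even M") auto

lemma kappa_eq: "\<kappa> = g + p - q"
  by (simp add: rho2_diff)

lemma kappa_pos: "\<kappa> > 0"
  using g_pos pmq by (simp add: kappa_eq)

text \<open>The second factor is always positive. Each of the others is positive for one parity of
  \<open>M\<close>; for the other parity, truncation reduces it to a difference of indices whose
  zero lies just outside the range.\<close>

lemma low_factors_nonzero:
  shows "2 * e < M \<Longrightarrow> p - r1 + 1/2 + real e \<noteq> 0" and "2 * e < M \<Longrightarrow> p - q + 1/2 + real e \<noteq> 0"
    and "2 * e + 1 < M \<Longrightarrow> p + \<rho>2 + 1 + real e \<noteq> 0"
proof -
  show "p - q + 1/2 + real e \<noteq> 0" using pmq by linarith
  show "p - r1 + 1/2 + real e \<noteq> 0" if "2 * e < M"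
  proof (cases "even M")
    case True
    have "2 * real e < real M" using that by linarith
    then show ?thesis using trunc_even[OF True] by (simp add: field_simps)
  next
    case False
    have "real M / 2 \<ge> 0" "real e \<ge> 0" by simp_all
    with trunc_odd[OF False] p_pos g_pos show ?thesis by linarith
  qed
  show "p + \<rho>2 + 1 + real e \<noteq> 0" if "2 * e + 1 < M"
  proof (cases "even M")
    case True
    have "real M / 2 \<ge> 0" "real e \<ge> 0" by simp_all
    with trunc_even[OF True] p_pos g_pos show ?thesis by linarith
  next
    case False
    have "2 * real e + 1 < real M" using that by linarith
    then show ?thesis using trunc_odd[OF False] by (simp add: field_simps)
  qed
qed

lemma lw_nonzero:
  assumes "1 \<le> k" "k \<le> M"
  shows "lw k \<noteq> 0"
proof (cases "even k")
  case True
  then obtain e where "k = 2 * e" by (elim evenE)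
  with assms have k: "k = 2 * Suc (e - 1)" "2 * (e - 1) + 1 < M" by auto
  have "lw k = - (real (Suc (e - 1)) * (p + \<rho>2 + 1 + real (e - 1)))"
    unfolding k(1) by (simp add: low_def field_simps)
  with low_factors_nonzero(3)[OF k(2)] show ?thesis by simp
next
  case False
  then obtain e where k: "k = Suc (2 * e)" by (auto elim: oddE)
  have "lw k = - ((p - r1 + 1/2 + real e) * (p - q + 1/2 + real e))"
    unfolding k by (simp add: low_def algebra_simps)
  with low_factors_nonzero(1,2)[of e] assms k show ?thesis by simp
qed

lemma lw_0: "lw 0 = 0"
  by (simp add: low_def)

section \<open>The kernel and its two equations\<close>

text \<open>Here \<open>n\<close> is the degree and \<open>j\<close> the index of the grid point.
  The summand treats the two grids symmetrically.\<close>

definition ker :: "nat \<Rightarrow> nat \<Rightarrow> real" where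
  "ker n j = (\<Sum>k\<le>M. newton p k (node p j) * newton (\<kappa> / 2) k (node (\<kappa> / 2) n) / (\<Prod>i=1..k. lw i))"

text \<open>The boundary term vanishes because, for \<open>n \<le> M\<close>, the dual node of index
  \<open>n\<close> is a zero of the dual Newton polynomial of degree \<open>Suc M\<close>.\<close>

lemma ker_difference:
  assumes "n \<le> M"
  shows "upg j * (ker n (Suc j) - ker n j) + dwg j * (ker n (j - 1) - ker n j) = lam n * ker n j"
  unfolding ker_def
proof (rule bidiagonal_expansion[where S = "\<lambda>F. \<Sum>k\<le>M. F k * newton (\<kappa> / 2) k (node (\<kappa> / 2) n) / (\<Prod>i=1..k. lw i)"])
  show "upg j * (newton p k (node p (Suc j)) - newton p k (node p j))
      + dwg j * (newton p k (node p (j - 1)) - newton p k (node p j))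
      = lam k * newton p k (node p j) + lw k * newton p (k - 1) (node p j)" for k
    by (rule up_down_newton[OF p_pos])
  show "newton (\<kappa> / 2) (Suc k) (node (\<kappa> / 2) n) = (lam n - lam k) * newton (\<kappa> / 2) k (node (\<kappa> / 2) n)" for k
    by (simp add: eig_node[OF refl])
  show "newton p M (node p j) * newton (\<kappa> / 2) (Suc M) (node (\<kappa> / 2) n) = 0"
    using assms by (simp add: newton_node_eq_0 del: newton_Suc)
qed (simp_all add: lw_nonzero lw_0)

text \<open>The same argument with the grids exchanged. Now \<open>j \<le> M\<close> removes the
  boundary term, so the degree \<open>n\<close> is unrestricted.\<close>

lemma ker_recurrence:
  assumes "j \<le> M"
  shows "A n * (ker (Suc n) j - ker n j) + C n * (ker (n - 1) j - ker n j) = (node p j - p) * ker n j"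
proof -
  have ker: "ker n j = (\<Sum>k\<le>M. newton (\<kappa> / 2) k (node (\<kappa> / 2) n) * newton p k (node p j) / (\<Prod>i=1..k. lw i))" for n
    by (simp add: ker_def mult.commute)
  show ?thesis
    unfolding ker
  proof (rule bidiagonal_expansion[where S = "\<lambda>F. \<Sum>k\<le>M. F k * newton p k (node p j) / (\<Prod>i=1..k. lw i)"])
    show "A n * (newton (\<kappa> / 2) k (node (\<kappa> / 2) (Suc n)) - newton (\<kappa> / 2) k (node (\<kappa> / 2) n))
      + C n * (newton (\<kappa> / 2) k (node (\<kappa> / 2) (n - 1)) - newton (\<kappa> / 2) k (node (\<kappa> / 2) n))
      = (node p k - p) * newton (\<kappa> / 2) k (node (\<kappa> / 2) n) + lw k * newton (\<kappa> / 2) (k - 1) (node (\<kappa> / 2) n)" for k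
      unfolding BI_A_eq_up[OF refl] BI_C_eq_down[OF refl]
      by (subst up_down_newton) (use kappa_pos in \<open>simp_all add: eig_dual[OF refl] low_dual\<close>)
    show "newton p (Suc k) (node p j) = ((node p j - p) - (node p k - p)) * newton p k (node p j)" for k
      by simp
    show "newton (\<kappa> / 2) M (node (\<kappa> / 2) n) * newton p (Suc M) (node p j) = 0"
      using assms by (simp add: newton_node_eq_0 del: newton_Suc)
  qed (simp_all add: lw_nonzero lw_0)
qed

lemma ker_0: "ker 0 j = 1"
proof -
  have "ker 0 j = (\<Sum>k\<le>M. if k = 0 then 1 else 0)"
    unfolding ker_def by (intro sum.cong) (auto simp: newton_node_eq_0 simp del: node_0)
  then show ?thesis by simp
qed

text \<open>The kernel starts with 1 and has leading recurrence coefficient \<open>A n\<close>; the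
  product converts it to the monic normalization.\<close>

lemma BI_node:
  assumes "j \<le> M"
  shows "BI p \<rho>2 r1 q n (node p j) = (\<Prod>i<n. A i) * ker n j"
proof (induction n rule: induct_nat_012)
  case 0
  show ?case by (simp add: ker_0)
next
  case 1
  have "C 0 = 0" by (simp add: BI_C_def)
  then show ?case
    using ker_recurrence[OF assms, of 0] by (simp add: ker_0 algebra_simps)
next
  case (ge2 n)
  let ?x = "node p j"
  have "BI p \<rho>2 r1 q (Suc (Suc n)) ?x
     = (\<Prod>i<Suc n. A i) * ((?x - p + A (Suc n) + C (Suc n)) * ker (Suc n) j - C (Suc n) * ker n j)"
    unfolding BI.simps(3) ge2 prod.lessThan_Suc by algebra
  also have "(?x - p + A (Suc n) + C (Suc n)) * ker (Suc n) j - C (Suc n) * ker n j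
     = A (Suc n) * ker (Suc (Suc n)) j"
    using ker_recurrence[OF assms, of "Suc n"] by (simp add: algebra_simps)
  finally show ?case by (simp add: mult.assoc)
qed

lemma A_top: "A M = 0"
proof (cases "even M")
  case True
  then show ?thesis using trunc_even by (simp add: BI_A_def)
next
  case False
  then have "real (ppart M) = 1" by (simp add: odd_iff_mod_2_eq_one)
  moreover have "real M + 2 * p - 2 * q + (2 * q + 2 * \<rho>2) + 1 = 0"
    using trunc_odd[OF False] by simp
  ultimately show ?thesis by (simp add: BI_A_def)
qed

text \<open>The product in \<open>BI_node\<close> contains \<open>A M\<close>. This settles the
  orthogonality relation when the second degree exceeds \<open>M\<close>.\<close>

lemma BI_node_eq_0:
  assumes "j \<le> M" "M < n"
  shows "BI p \<rho>2 r1 q n (node p j) = 0"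
proof -
  have "(\<Prod>i<n. A i) = 0"
    using assms A_top by (intro prod_zero) auto
  then show ?thesis by (simp add: BI_node[OF assms(1)])
qed

section \<open>Symmetry and orthogonality\<close>

lemma weight_balance:
  assumes "k < M"
  shows "wt k * upg k = wt (Suc k) * dwg (Suc k)"
proof (cases "even k")
  case True
  then obtain e where k: "k = 2 * e" by (elim evenE)
  have "p + q + 1/2 + real e \<noteq> 0" using ppq by linarith
  moreover have "p + r1 + 1/2 + real e \<noteq> 0"
  proof (cases "even M")
    case True
    have "real M / 2 \<ge> 0" "real e \<ge> 0" by simp_all
    with trunc_even[OF True] p_pos show ?thesis by linarith
  next
    case False
    have "2 * real e < real M" using assms k by linarith
    with trunc_odd[OF False] g_pos show ?thesis by (auto simp: field_simps)
  qed
  moreover have "upg k = (p - r1 + 1/2 + real e) * (p - q + 1/2 + real e) / (2 * (p + real e) + 1)"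
    by (simp add: k up_def reflG_def) (simp add: algebra_simps)
  moreover have "dwg (Suc k) = - ((p + q + 1/2 + real e) * (p + r1 + 1/2 + real e) / (2 * (p + real e) + 1))"
    (is "_ = - (?n / ?d)")
  proof -
    have "dwg (Suc k) = ?n / - ?d"
      by (simp add: k down_def reflG_def) (simp add: algebra_simps)
    then show ?thesis by (simp only: divide_minus_right)
  qed
  ultimately show ?thesis
    unfolding k BI_w_Suc_even by simp
next
  case False
  then obtain e where k: "k = Suc (2 * e)" by (auto elim: oddE)
  have "p - \<rho>2 + 1 + real e \<noteq> 0"
  proof (cases "even M")
    case True
    have "2 * real e + 1 < real M" using assms k by linarith
    with trunc_even[OF True] g_pos show ?thesis by (auto simp: field_simps)
  next
    case False
    have "real M / 2 \<ge> 0" "real e \<ge> 0" by simp_all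
    with trunc_odd[OF False] p_pos show ?thesis by linarith
  qed
  moreover have "upg k = (p + \<rho>2 + 1 + real e) * (2 * p + 1 + real e) / (2 * (p + real e + 1))"
    (is "_ = ?n / ?d")
  proof -
    have "upg k = - ((- (2 * p + 1 + real e)) * (- (p + \<rho>2 + 1 + real e)) / - ?d)"
      by (simp add: k up_def reflF_def del: minus_add_distrib) (simp add: algebra_simps)
    then show ?thesis by (simp del: minus_add_distrib)
  qed
  moreover have "dwg (Suc k) = - (real (Suc e) * (p - \<rho>2 + 1 + real e) / (2 * (p + real e + 1)))"
  proof -
    have "Suc k = 2 * Suc e" by (simp add: k)
    then show ?thesis by (simp only: down_def reflF_def node_even) (simp add: algebra_simps)
  qed
  ultimately show ?thesis
    unfolding k BI_w_Suc_odd by (simp del: of_nat_Suc)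
qed

text \<open>The last node is a root of a coefficient: \<open>r1 - 1/2\<close> in
  \<open>reflG\<close> for even \<open>M\<close>, \<open>\<rho>2\<close> in \<open>reflF\<close> for
  odd \<open>M\<close>. Hence the operator does not leave the grid, and the boundary term of
  summation by parts is 0.\<close>

lemma up_top: "upg M = 0"
proof (cases "even M")
  case True
  then have "node p M - (r1 - 1/2) = 0"
    using trunc_even by (simp add: node_def)
  with True show ?thesis by (simp add: up_def reflG_def)
next
  case False
  then have "node p M - \<rho>2 = 0"
    using trunc_odd by (simp add: node_def field_simps)
  with False show ?thesis by (simp add: up_def reflF_def)
qed

lemma operator_symmetric:
  "(\<Sum>k\<le>M. wt k * (upg k * (f (Suc k) - f k) + dwg k * (f (k - 1) - f k)) * h k)
   = (\<Sum>k\<le>M. wt k * (upg k * (h (Suc k) - h k) + dwg k * (h (k - 1) - h k)) * f k)"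
proof -
  have parts: "(\<Sum>k\<le>M. wt k * (upg k * (f (Suc k) - f k) + dwg k * (f (k - 1) - f k)) * h k)
     = wt M * upg M * (f (Suc M) - f M) * h M
       - (\<Sum>k<M. wt k * upg k * (f (Suc k) - f k) * (h (Suc k) - h k))" for f h
    by (rule summation_by_parts_tridiagonal) (simp_all add: weight_balance)
  show ?thesis
    unfolding parts[of f h] parts[of h f] up_top
    by (simp add: mult_ac)
qed

text \<open>As \<open>\<kappa>\<close> is positive, even indices give nonnegative eigenvalues and
  odd ones negative eigenvalues.\<close>

lemma lam_inj:
  assumes "lam n = lam m"
  shows "n = m"
proof -
  have e: "lam k = (if even k then real k / 2 else - (\<kappa> + (real k + 1) / 2))" for k
    by (simp add: eig_def field_simps)
  show ?thesis
    using assms kappa_pos unfolding e by (auto split: if_splits simp: field_simps)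
qed

lemma orthogonal:
  assumes "n \<le> M" "n \<noteq> m"
  shows "(\<Sum>k\<le>M. wt k * BI p \<rho>2 r1 q n (node p k) * BI p \<rho>2 r1 q m (node p k)) = 0"
proof (cases "m \<le> M")
  case True
  let ?S = "\<Sum>k\<le>M. wt k * ker n k * ker m k"
  have "lam n * ?S = (\<Sum>k\<le>M. wt k * (lam n * ker n k) * ker m k)"
    by (simp add: sum_distrib_left mult_ac)
  also have "\<dots> = (\<Sum>k\<le>M. wt k * (lam m * ker m k) * ker n k)"
    unfolding ker_difference[OF assms(1), symmetric] ker_difference[OF True, symmetric]
    by (rule operator_symmetric)
  also have "\<dots> = lam m * ?S"
    by (simp add: sum_distrib_left mult_ac)
  finally have "?S = 0" using lam_inj assms(2) by auto
  moreover have "(\<Sum>k\<le>M. wt k * BI p \<rho>2 r1 q n (node p k) * BI p \<rho>2 r1 q m (node p k))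
     = (\<Prod>i<n. A i) * (\<Prod>i<m. A i) * ?S"
    unfolding sum_distrib_left by (intro sum.cong) (simp_all add: BI_node mult_ac)
  ultimately show ?thesis by simp
next
  case False
  then show ?thesis by (intro sum.neutral) (simp add: BI_node_eq_0)
qed

section \<open>Norms from the recurrence and the total mass\<close>

definition nrm :: "nat \<Rightarrow> real" where
  "nrm n = (\<Sum>k\<le>M. wt k * (BI p \<rho>2 r1 q n (node p k))\<^sup>2)"

text \<open>The pairing of \<open>x\<close> times the polynomial of degree \<open>n\<close> with the
  one of degree \<open>Suc n\<close> is expanded by the recurrence at either degree, and the results
  are compared.\<close>

lemma nrm_Suc:
  assumes "n < M"
  shows "nrm (Suc n) = A n * C (Suc n) * nrm n"
proof -
  let ?B = "\<lambda>n k. BI p \<rho>2 r1 q n (node p k)" and ?b = "\<lambda>n. p - A n - C n"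
  let ?I = "\<lambda>n m. \<Sum>k\<le>M. wt k * ?B n k * ?B m k"
  \<comment> \<open>The last factor drops the term of degree -1 when \<open>n = 0\<close>, where
    \<open>n - 1\<close> is truncated to 0.\<close>
  let ?u = "A (n - 1) * C n * (if n = 0 then 0 else 1)"
  have x1: "?B (Suc n) k = (node p k - ?b n) * ?B n k - ?u * ?B (n - 1) k" for k
    by (cases n) simp_all
  have x2: "?B (Suc (Suc n)) k = (node p k - ?b (Suc n)) * ?B (Suc n) k - A n * C (Suc n) * ?B n k" for k
    by simp
  have "?I (Suc n) (Suc n) + (?b n) * ?I (Suc n) n + ?u * ?I (Suc n) (n - 1)
     = ?I (Suc (Suc n)) n + (?b (Suc n)) * ?I (Suc n) n + A n * C (Suc n) * ?I n n"
    unfolding sum_distrib_left sum.distrib[symmetric]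
  proof (intro sum.cong refl)
    fix k
    show "wt k * ?B (Suc n) k * ?B (Suc n) k + ?b n * (wt k * ?B (Suc n) k * ?B n k)
         + ?u * (wt k * ?B (Suc n) k * ?B (n - 1) k)
       = wt k * ?B (Suc (Suc n)) k * ?B n k + ?b (Suc n) * (wt k * ?B (Suc n) k * ?B n k)
         + A n * C (Suc n) * (wt k * ?B n k * ?B n k)"
      using x1[of k] x2[of k] by algebra
  qed
  moreover have "?I (Suc n) n = 0" "?I (Suc n) (n - 1) = 0"
    using assms by (intro orthogonal; simp)+
  \<comment> \<open>The degree \<open>Suc (Suc n)\<close> may exceed \<open>M\<close>, so
    \<open>n\<close> takes the place of the bounded degree.\<close>
  moreover have "?I (Suc (Suc n)) n = 0"
    using orthogonal[of n "Suc (Suc n)"] assms by (simp add: mult_ac)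
  ultimately show ?thesis
    by (simp add: nrm_def power2_eq_square mult_ac)
qed

lemma nrm_0_product:
  "nrm 0 = wt M * newton p M (node p M) * (\<Prod>i=1..M. - lam i / lw i)"
proof -
  define T where "T k = (\<Sum>j\<le>M. wt j * newton p k (node p j))" for k
  have T: "lam k * T k + lw k * T (k - 1) = 0" for k
  proof -
    have "lam k * T k + lw k * T (k - 1)
      = (\<Sum>j\<le>M. wt j * (lam k * newton p k (node p j) + lw k * newton p (k - 1) (node p j)) * 1)"
      unfolding T_def sum_distrib_left sum.distrib[symmetric]
      by (intro sum.cong) (simp_all add: algebra_simps)
    \<comment> \<open>Symmetry moves the operator onto the constant function 1, which it
      annihilates.\<close>
    also have "\<dots> = 0"
      unfolding up_down_newton[OF p_pos, symmetric]
      by (subst operator_symmetric[where h = "\<lambda>_. 1"]) simp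
    finally show ?thesis .
  qed
  have "T 0 = (\<Prod>i=1..k. - lam i / lw i) * T k" if "k \<le> M" for k
    using that
  proof (induction k)
    case (Suc k)
    have "T k = - lam (Suc k) / lw (Suc k) * T (Suc k)"
      using T[of "Suc k"] lw_nonzero[of "Suc k"] Suc.prems by (simp add: field_simps)
    with Suc show ?case by simp
  qed simp
  then have "T 0 = (\<Prod>i=1..M. - lam i / lw i) * T M" by blast
  moreover have "T M = (\<Sum>j\<le>M. if j = M then wt M * newton p M (node p M) else 0)"
    unfolding T_def by (intro sum.cong) (auto simp: newton_node_eq_0)
  moreover have "T 0 = nrm 0" by (simp add: T_def nrm_def)
  ultimately show ?thesis by (simp add: mult_ac)
qed

end

section \<open>Closed form and positivity of the norms\<close>

lemma pochhammer_nonzero: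
  fixes x :: real
  shows "(\<And>k. k < n \<Longrightarrow> x + real k \<noteq> 0) \<Longrightarrow> pochhammer x n \<noteq> 0"
  by (auto simp: pochhammer_eq_0_iff eq_neg_iff_add_eq_0)

lemma pochhammer_shift:
  fixes x :: real
  assumes "x \<noteq> 0"
  shows "pochhammer (x + 1) n = pochhammer x n * (x + real n) / x"
  using pochhammer_rec[of x n] pochhammer_rec'[of x n] assms by (simp add: field_simps)

text \<open>The two coefficients share their denominator, which is the origin of the squared
  Pochhammer symbol in \<open>BI_h\<close>.\<close>

lemma BI_AC_even:
  fixes \<rho>1 \<rho>2 r1 r2 :: real
  shows "BI_A \<rho>1 \<rho>2 r1 r2 (2 * e) * BI_C \<rho>1 \<rho>2 r1 r2 (Suc (2 * e))
    = - ((\<rho>1 - r1 + 1/2 + real e) * (\<rho>1 - r2 + 1/2 + real e)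
         * ((\<rho>2 - r2 + 1/2 + real e) * (\<rho>2 - r1 + 1/2 + real e))
       / (\<rho>1 + \<rho>2 - r1 - r2 + 2 * real e + 1)\<^sup>2)"
proof -
  have pp: "real (ppart (Suc (2 * e))) = 1" by simp
  have "BI_A \<rho>1 \<rho>2 r1 r2 (2 * e)
    = (2 * (\<rho>1 - r1 + 1/2 + real e)) * (2 * (\<rho>1 - r2 + 1/2 + real e)) / (4 * (\<rho>1 + \<rho>2 - r1 - r2 + 2 * real e + 1))"
    unfolding BI_A_def by (intro arg_cong2[where f = "(/)"] arg_cong2[where f = "(*)"]) simp_all
  moreover have "BI_C \<rho>1 \<rho>2 r1 r2 (Suc (2 * e))
    = - ((2 * (\<rho>2 - r2 + 1/2 + real e)) * (2 * (\<rho>2 - r1 + 1/2 + real e)) / (4 * (\<rho>1 + \<rho>2 - r1 - r2 + 2 * real e + 1)))"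
    unfolding BI_C_def pp
    by (intro arg_cong[where f = uminus] arg_cong2[where f = "(/)"] arg_cong2[where f = "(*)"]) simp_all
  ultimately show ?thesis
    unfolding quarter by (simp add: power2_eq_square)
qed

lemma BI_AC_odd:
  fixes \<rho>1 \<rho>2 r1 r2 :: real
  shows "BI_A \<rho>1 \<rho>2 r1 r2 (Suc (2 * e)) * BI_C \<rho>1 \<rho>2 r1 r2 (Suc (Suc (2 * e)))
    = - ((\<rho>1 + \<rho>2 - r1 - r2 + 1 + real e) * (\<rho>1 + \<rho>2 + 1 + real e)
         * ((1 + real e) * (1 - r1 - r2 + real e))
       / (\<rho>1 + \<rho>2 - r1 - r2 + 2 * real e + 2)\<^sup>2)"
proof -
  have pp: "real (ppart (Suc (2 * e))) = 1" by simp
  have "BI_A \<rho>1 \<rho>2 r1 r2 (Suc (2 * e))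
    = (2 * (\<rho>1 + \<rho>2 - r1 - r2 + 1 + real e)) * (2 * (\<rho>1 + \<rho>2 + 1 + real e)) / (4 * (\<rho>1 + \<rho>2 - r1 - r2 + 2 * real e + 2))"
    unfolding BI_A_def pp by (intro arg_cong2[where f = "(/)"] arg_cong2[where f = "(*)"]) simp_all
  moreover have "BI_C \<rho>1 \<rho>2 r1 r2 (Suc (Suc (2 * e)))
    = - ((2 * (1 + real e)) * (2 * (1 - r1 - r2 + real e)) / (4 * (\<rho>1 + \<rho>2 - r1 - r2 + 2 * real e + 2)))"
    unfolding BI_C_def
    by (intro arg_cong[where f = uminus] arg_cong2[where f = "(/)"] arg_cong2[where f = "(*)"]) simp_all
  ultimately show ?thesis
    unfolding quarter by (simp add: power2_eq_square)
qed

context bannai_ito_grid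
begin

abbreviation "E \<equiv> epart M"
abbreviation "Q \<equiv> ppart M"

lemma nrm_0_pochhammer:
  "nrm 0 = (-1) ^ (E + Q) * pochhammer (\<kappa> + 1) (E + Q) * pochhammer (2 * p + 1) (E + (E + Q))
     / (pochhammer (p + q + 1/2) (E + Q) * pochhammer (p + r1 + 1/2) (E + Q) * pochhammer (p - \<rho>2 + 1) E)"
proof -
  have lt: "2 * k < M" if "k < E + Q" for k using that by presburger
  have lt': "2 * k + 1 < M" if "k < E" for k using that by presburger
  have nz: "pochhammer (p + \<rho>2 + 1) E \<noteq> 0"
    using low_factors_nonzero(3)[OF lt'] by (intro pochhammer_nonzero)
  have nz': "pochhammer (p - r1 + 1/2) (E + Q) \<noteq> 0" "pochhammer (p - q + 1/2) (E + Q) \<noteq> 0"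
    using low_factors_nonzero(1,2)[OF lt] by (intro pochhammer_nonzero; blast)+
  show ?thesis
    unfolding nrm_0_product prod_eig_low[OF refl] newton_diagonal BI_w_def
      pochhammer_product'[of "2 * p + 1" E "E + Q"]
    using nz nz' by (simp add: power_add mult_ac flip: power_mult_distrib)
qed

text \<open>Truncation turns one denominator into the tail of the Pochhammer symbol at
  \<open>2 * p + 1\<close> and reflects the other into one at \<open>g + 1/2\<close>, which absorbs
  the sign. The parity of \<open>M\<close> decides which is which.\<close>

lemma nrm_0: "nrm 0 = BI_h p \<rho>2 r1 q M 0"
proof (cases "even M")
  case True
  then have Q: "Q = 0" and M: "real M / 2 = real E" by auto
  have 1: "pochhammer (p + r1 + 1/2) E = pochhammer (2 * p + 1 + real E) E"
    using trunc_even[OF True] M by (simp add: algebra_simps)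
  have "p - \<rho>2 + 1 = - (real E + g - 1/2)" using trunc_even[OF True] M by simp
  then have 2: "pochhammer (p - \<rho>2 + 1) E = (-1) ^ E * pochhammer (g + 1/2) E"
    using pochhammer_minus[of "real E + g - 1/2" E] by (simp add: add_ac)
  have s: "E + (E + Q) = E + E" "E + Q = E" by (simp_all add: Q)
  have "pochhammer (2 * p + 1 + real E) E > 0" "pochhammer (g + 1/2) E > 0"
    using p_pos g_pos by (simp_all add: pochhammer_pos)
  then show ?thesis
    unfolding nrm_0_pochhammer BI_h_def s pochhammer_product'[of "2 * p + 1" E E] 1 2
    by (simp add: rho2_diff Q)
next
  case False
  then have Q: "Q = 1" by (simp add: odd_iff_mod_2_eq_one)
  have "real M = real (2 * E + Q)" by simp
  then have M: "real M / 2 = real E + 1/2"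
    unfolding Q of_nat_add of_nat_mult by simp
  have c: "p + r1 + 1/2 = - (real E + g + 1/2)" using trunc_odd[OF False] M by simp
  then have 1: "pochhammer (p + r1 + 1/2) (Suc E) = - ((-1) ^ E * pochhammer (g + 1/2) (Suc E))"
    unfolding c pochhammer_minus by (simp add: add_ac)
  have "p - \<rho>2 + 1 = 2 * p + 1 + real (Suc E)" using trunc_odd[OF False] M by simp
  then have 2: "pochhammer (p - \<rho>2 + 1) E = pochhammer (2 * p + 1 + real (Suc E)) E" by (simp only:)
  have s: "E + Q = Suc E" "E + Suc E = Suc E + E" by (simp_all add: Q)
  have 3: "pochhammer (2 * p + 1) (Suc E + E) = pochhammer (2 * p + 1) (Suc E) * pochhammer (2 * p + 1 + real (Suc E)) E"
    by (rule pochhammer_product')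
  have "pochhammer (2 * p + 1 + real (Suc E)) E > 0" "pochhammer (g + 1/2) (Suc E) > 0"
    using p_pos g_pos by (simp_all add: pochhammer_pos)
  then show ?thesis
    unfolding nrm_0_pochhammer BI_h_def s 1 2 3
    by (simp add: rho2_diff Q del: of_nat_Suc)
qed

lemma h_ratio_even:
  assumes "2 * e < M"
  shows "BI_h p \<rho>2 r1 q M (Suc (2 * e)) = A (2 * e) * C (Suc (2 * e)) * BI_h p \<rho>2 r1 q M (2 * e)"
proof -
  have k: "\<kappa> + 2 * real e + 1 = \<kappa> + real e + 1 + real e" by simp
  have g: "\<rho>2 - r1 = g" by (simp add: rho2_diff)
  have es: "pochhammer x (e + 1) = pochhammer x e * (x + real e)" for x :: real
    by (simp add: pochhammer_Suc)
  have gr: "pochhammer (g + real e + 1/2) (Suc d) = (g + 1/2 + real e) * pochhammer (g + real e + 1 + 1/2) d" for d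
    by (simp add: pochhammer_rec add_ac)
  have nz: "\<kappa> + real e + 1 + real e \<noteq> 0" "pochhammer (\<kappa> + real e + 1) e \<noteq> 0"
    "pochhammer (g + real e + 1 + 1/2) d \<noteq> 0" "g + 1/2 + real e \<noteq> 0" for d
    using kappa_pos g_pos pochhammer_pos[of "\<kappa> + real e + 1" e] pochhammer_pos[of "g + real e + 1 + 1/2" d]
    by linarith+
  show ?thesis
  proof (cases "even M")
    case True
    define d where "d = E - Suc e"
    have M: "M = 2 * (e + Suc d)" using assms True by (auto simp: d_def elim!: evenE)
    \<comment> \<open>This factor yields the quotient of the two factorials in \<open>BI_h\<close>,
      and its sign cancels the one in \<open>BI_AC_even\<close>. For odd \<open>M\<close> the same
      role falls to a quotient of Pochhammer symbols at \<open>p + q + 1/2\<close>.\<close>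
    have r: "p - r1 + 1/2 + real e = - real (Suc d)" using trunc_even M by (simp add: field_simps)
    have eo: "epart M = e + Suc d" "ppart M = 0" "ppart (2 * e) = 0" "epart (2 * e) = e"
      "ppart (Suc (2 * e)) = 1" "epart (Suc (2 * e)) = e"
      "e + Suc d - e - 1 * (1 - 0) = d" "e + Suc d + 0 - e = Suc d" "e + Suc d + 0 - e - 1 = d"
      "e + Suc d - e - 0 * (1 - 0) = Suc d" "e + Suc d - e + 0 * (1 - 1) = Suc d"
      "e + Suc d - e + 0 * (1 - 0) = Suc d" "Suc d - 0 = Suc d"
      by (simp_all add: M)
    show ?thesis
      unfolding BI_h_def eo BI_AC_even r k of_nat_0 of_nat_1 unfolding g es add_0_right gr
      using nz(1,2,4) nz(3)[of d] by (simp add: divide_simps power2_eq_square mult_ac del: of_nat_Suc)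
  next
    case False
    define d where "d = E - e"
    have M: "M = Suc (2 * (e + d))" using assms False by (auto simp: d_def elim!: oddE)
    have r: "\<rho>2 - q + 1/2 + real e = - (p + q + 1/2 + real d)" using trunc_odd M by (simp add: field_simps)
    have r': "1 * (p - \<rho>2 - r1 + q) + \<rho>2 - q + 1/2 = p - r1 + 1/2" by simp
    have eo: "epart M = e + d" "ppart M = 1" "ppart (2 * e) = 0" "epart (2 * e) = e"
      "ppart (Suc (2 * e)) = 1" "epart (Suc (2 * e)) = e"
      "e + d - e - 1 * (1 - 1) = d" "e + d + 1 - e = Suc d" "e + d + 1 - e - 1 = d"
      "e + d - e - 0 * (1 - 1) = d" "e + d - e + 1 * (1 - 1) = d"
      "e + d - e + 1 * (1 - 0) = Suc d" "Suc d - 0 = Suc d"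
      by (simp_all add: M)
    have pp: "pochhammer (p + q + 1/2) (Suc d) = pochhammer (p + q + 1/2) d * (p + q + 1/2 + real d)"
      by (simp add: pochhammer_Suc)
    have "pochhammer (p + q + 1/2) d \<noteq> 0" "p + q + 1/2 + real d \<noteq> 0"
      using pochhammer_pos[of "p + q + 1/2" d] ppq by linarith+
    then show ?thesis
      unfolding BI_h_def eo BI_AC_even r k of_nat_0 of_nat_1 r' unfolding g es add_0_right gr pp
      using nz(1,2,4) nz(3)[of d] by (simp add: divide_simps power2_eq_square mult_ac del: of_nat_Suc)
  qed
qed

text \<open>The half-degree grows here, so the Pochhammer base moves from \<open>K\<close> to
  \<open>K + 1\<close>; \<open>pochhammer_shift\<close> makes the symbols comparable. As before,
  truncation supplies the missing quotient and sign.\<close>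

lemma h_ratio_odd:
  assumes "Suc (2 * e) < M"
  shows "BI_h p \<rho>2 r1 q M (Suc (Suc (2 * e)))
    = A (Suc (2 * e)) * C (Suc (Suc (2 * e))) * BI_h p \<rho>2 r1 q M (Suc (2 * e))"
proof -
  define K where "K = \<kappa> + real e + 1"
  have k: "\<kappa> + 2 * real e + 2 = K + real (Suc e)" "\<kappa> + 1 + real e = K" "\<kappa> + real (Suc e) + 1 = K + 1"
    "\<kappa> + real e + 1 = K"
    by (simp_all add: K_def)
  have g: "\<rho>2 - r1 = g" by (simp add: rho2_diff)
  have gs: "g + real (Suc e) + 0 + 1/2 = g + real e + 1 + 1/2" by simp
  have nz: "K \<noteq> 0" "K + real (Suc e) \<noteq> 0" "pochhammer K (Suc e) \<noteq> 0"
    using kappa_pos pochhammer_pos[of K "Suc e"] by (auto simp: K_def)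
  have Ks: "pochhammer (K + 1) (Suc e) = pochhammer K (Suc e) * (K + real (Suc e)) / K"
    by (rule pochhammer_shift[OF nz(1)])
  have Kd: "pochhammer K (Suc d) = K * pochhammer (K + 1) d" for d
    by (rule pochhammer_rec)
  have es: "pochhammer x (Suc e) = pochhammer x e * (x + real e)" for x :: real
    by (simp add: pochhammer_Suc)
  define d where "d = E - Suc e"
  show ?thesis
  proof (cases "even M")
    case True
    have M: "M = 2 * (e + Suc d)" using assms True by (auto simp: d_def elim!: evenE)
    have r: "1 - r1 - q + real e = - (p + q + 1/2 + real d)" using trunc_even M by (simp add: field_simps)
    have eo: "epart M = e + Suc d" "ppart M = 0" "ppart (Suc (Suc (2 * e))) = 0" "epart (Suc (Suc (2 * e))) = Suc e"
      "ppart (Suc (2 * e)) = 1" "epart (Suc (2 * e)) = e" "e + 1 = Suc e" "Suc e + 0 = Suc e"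
      "e + Suc d - e - 1 * (1 - 0) = d" "e + Suc d - Suc e - 0 * (1 - 0) = d"
      "e + Suc d + 0 - e = Suc d" "e + Suc d + 0 - Suc e = d"
      "Suc d - 1 = d" "d - 0 = d"
      "e + Suc d - e + 0 * (1 - 1) = Suc d" "e + Suc d - Suc e + 0 * (1 - 0) = d"
      by (simp_all add: M)
    have pp: "pochhammer (p + q + 1/2) (Suc d) = pochhammer (p + q + 1/2) d * (p + q + 1/2 + real d)"
      by (simp add: pochhammer_Suc)
    have r': "- 0 * (p + \<rho>2 + r1 + q) + p + \<rho>2 + 1 = p + \<rho>2 + 1" by simp
    have f: "fact (Suc e) = (1 + real e) * fact e" by simp
    have "pochhammer (p + q + 1/2) d \<noteq> 0" "p + q + 1/2 + real d \<noteq> 0"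
      using pochhammer_pos[of "p + q + 1/2" d] ppq by linarith+
    then show ?thesis
      unfolding BI_h_def eo BI_AC_odd r k of_nat_0 of_nat_1 r' unfolding g gs f Ks Kd[of d] pp es[of "p + \<rho>2 + 1"]
      using nz by (simp add: divide_simps power2_eq_square mult_ac del: of_nat_Suc)
  next
    case False
    have M: "M = Suc (2 * (e + Suc d))" using assms False by (auto simp: d_def elim!: oddE)
    have r: "p + \<rho>2 + 1 + real e = - real (Suc d)" using trunc_odd M by (simp add: field_simps)
    have eo: "epart M = e + Suc d" "ppart M = 1" "ppart (Suc (Suc (2 * e))) = 0" "epart (Suc (Suc (2 * e))) = Suc e"
      "ppart (Suc (2 * e)) = 1" "epart (Suc (2 * e)) = e" "e + 1 = Suc e" "Suc e + 0 = Suc e"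
      "e + Suc d - e - 1 * (1 - 1) = Suc d" "e + Suc d - Suc e - 0 * (1 - 1) = d"
      "e + Suc d + 1 - e = Suc (Suc d)" "e + Suc d + 1 - Suc e = Suc d"
      "Suc (Suc d) - 1 = Suc d" "Suc d - 0 = Suc d"
      "e + Suc d - e + 1 * (1 - 1) = Suc d" "e + Suc d - Suc e + 1 * (1 - 0) = Suc d"
      by (simp_all add: M)
    have r': "- 1 * (p + \<rho>2 + r1 + q) + p + \<rho>2 + 1 = 1 - r1 - q" by simp
    have f: "fact (Suc n) = real (Suc n) * fact n" for n by simp
    show ?thesis
      unfolding BI_h_def eo BI_AC_odd r k of_nat_0 of_nat_1 r' unfolding g gs f Ks Kd[of "Suc d"] es[of "1 - r1 - q"]
      using nz by (simp add: divide_simps power2_eq_square mult_ac del: of_nat_Suc)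
  qed
qed

lemma h_ratio:
  assumes "n < M"
  shows "BI_h p \<rho>2 r1 q M (Suc n) = A n * C (Suc n) * BI_h p \<rho>2 r1 q M n"
proof (cases "even n")
  case True
  then obtain e where n: "n = 2 * e" by (elim evenE)
  show ?thesis using h_ratio_even[of e] assms unfolding n by simp
next
  case False
  then obtain e where n: "n = Suc (2 * e)" by (auto elim: oddE)
  show ?thesis using h_ratio_odd[of e] assms unfolding n by simp
qed

lemma nrm_eq_BI_h: "n \<le> M \<Longrightarrow> nrm n = BI_h p \<rho>2 r1 q M n"
  by (induction n) (simp_all add: nrm_0 nrm_Suc h_ratio)

lemma BI_orthogonality:
  assumes "n \<le> M"
  shows "(\<Sum>k\<le>M. wt k * BI p \<rho>2 r1 q n (node p k) * BI p \<rho>2 r1 q m (node p k))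
    = (if n = m then BI_h p \<rho>2 r1 q M n else 0)"
  using orthogonal[OF assms, of m] nrm_eq_BI_h[OF assms]
  by (auto simp: nrm_def power2_eq_square mult_ac)

text \<open>Positivity allows the norms to be cancelled against the denominator of
  \<open>Omega\<close>. Only the two arguments that contain \<open>ppart M\<close> need a case split
  on parity.\<close>

lemma BI_h_pos: "BI_h p \<rho>2 r1 q M n > 0"
proof -
  have M: "real M / 2 \<ge> 0" by simp
  have 1: "real (ppart M) * (p - \<rho>2 - r1 + q) + \<rho>2 - q + 1/2 > 0"
    "- real (ppart M) * (p + \<rho>2 + r1 + q) + p + \<rho>2 + 1 > 0"
  proof -
    have "real (ppart M) * (p - \<rho>2 - r1 + q) + \<rho>2 - q + 1/2 > 0
      \<and> - real (ppart M) * (p + \<rho>2 + r1 + q) + p + \<rho>2 + 1 > 0"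
    proof (cases "even M")
      case True
      then have Q: "real (ppart M) = 0" by auto
      show ?thesis unfolding Q using trunc_even[OF True, THEN conjunct1] trunc_even[OF True, THEN conjunct2]
          p_pos g_pos pmq M by (intro conjI; linarith)
    next
      case False
      then have Q: "real (ppart M) = 1" by (simp add: odd_iff_mod_2_eq_one)
      show ?thesis unfolding Q using trunc_odd[OF False, THEN conjunct1] trunc_odd[OF False, THEN conjunct2]
          p_pos g_pos pmq M by (simp add: field_simps)
    qed
    then show "real (ppart M) * (p - \<rho>2 - r1 + q) + \<rho>2 - q + 1/2 > 0"
      "- real (ppart M) * (p + \<rho>2 + r1 + q) + p + \<rho>2 + 1 > 0" by auto
  qed
  show ?thesis
    unfolding BI_h_def
    by (intro mult_pos_pos divide_pos_pos zero_less_power pochhammer_pos 1 fact_gt_zero)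
      (use kappa_pos p_pos pmq ppq g_pos rho2_diff in linarith)+
qed

end

subsection \<open>Iterated sums\<close>

lemma asum_Suc: "i \<le> Suc j \<Longrightarrow> asum \<alpha> i (Suc j) = asum \<alpha> i j + \<alpha> (Suc j)"
  by (simp add: asum_def)

lemma asum_split_first: "1 \<le> i \<Longrightarrow> asum \<alpha> 1 i = \<alpha> 1 + asum \<alpha> 2 i"
  by (simp add: asum_def sum.atLeast_Suc_atMost numeral_2_eq_2)

lemma XX_truncated:
  assumes "psum n (i - 1) \<le> y" "1 \<le> i"
  shows "XX \<alpha> n i (int y)
    = (-1) ^ (y - psum n (i - 1)) * (real (y - psum n (i - 1)) / 2 + rho1 \<alpha> n i + \<alpha> (i + 1) / 4 + 1/4)"
proof -
  obtain d where y: "y = psum n (i - 1) + d"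
    using assms(1) by (auto simp: le_iff_add)
  have "(-1 :: real) powi (int (psum n (i - 1)) + int y) = (-1) ^ (2 * psum n (i - 1) + d)"
    unfolding y by (simp add: mult_2 add.assoc flip: of_nat_add)
  then show ?thesis
    by (simp add: XX_def y rho1_def asum_Suc power_add field_simps)
qed

text \<open>The exponent has the parity of the difference of \<open>x\<close> and the partial sum,
  and \<open>rho1\<close> already contains half of that sum, so only the difference matters.\<close>

lemma grid_point:
  assumes "psum n (i - 1) \<le> x"
  shows "(-1) powi (int (psum n (i - 1)) + int x) / 2 * (real_of_int (int x) + asum \<alpha> 1 i / 2) - 1/4
    = node (rho1 \<alpha> n i) (x - psum n (i - 1))"
proof -
  obtain d where x: "x = psum n (i - 1) + d"
    using assms(1) by (auto simp: le_iff_add)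
  have "(-1 :: real) powi (int (psum n (i - 1)) + int x) = (-1) ^ (2 * psum n (i - 1) + d)"
    unfolding x by (simp add: mult_2 add.assoc flip: of_nat_add)
  then show ?thesis
    by (cases "even d") (simp_all add: x rho1_def node_def power_add field_simps)
qed

section \<open>Splitting the summand into layers\<close>

definition BI_factor ::
  "(nat \<Rightarrow> real) \<Rightarrow> real \<Rightarrow> (nat \<Rightarrow> nat) \<Rightarrow> nat \<Rightarrow> int \<Rightarrow> int \<Rightarrow> real" where
  "BI_factor \<alpha> \<beta> n k x y =
     BI (rho1 \<alpha> n k) (rho2 \<alpha> n k y) (rr1 \<alpha> n k y) (rr2 \<alpha> \<beta> n k) (n k)
       ((-1) powi (int (psum n (k - 1)) + x) / 2 * (real_of_int x + asum \<alpha> 1 k / 2) - 1/4)"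

text \<open>The denominator \<open>norm_h (i - 1)\<close> depends on the point only through
  \<open>l i\<close>. Placed in layer \<open>i\<close>, it meets the norm produced by the sum over
  the entry of index \<open>i - 1\<close>.\<close>

definition layer ::
  "(nat \<Rightarrow> real) \<Rightarrow> real \<Rightarrow> (nat \<Rightarrow> nat) \<Rightarrow> (nat \<Rightarrow> nat) \<Rightarrow> nat \<Rightarrow> (nat \<Rightarrow> nat) \<Rightarrow> real" where
  "layer \<alpha> \<beta> n m i l =
     weight_w i l n \<alpha> \<beta> * BI_factor \<alpha> \<beta> n i (int (l i)) (int (l (i + 1)))
       * BI_factor \<alpha> \<beta> m i (int (l i)) (int (l (i + 1)))
     / (if i = 1 then 1 else norm_h (i - 1) l n \<alpha> \<beta>)"

lemma iter_sum_cong: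
  "(\<And>l'. (\<And>i. k < i \<Longrightarrow> l' i = l i) \<Longrightarrow> F l' = G l') \<Longrightarrow> iter_sum k F l = iter_sum k G l"
proof (induction k arbitrary: l)
  case (Suc k)
  have "iter_sum k F (l(k + 1 := j)) = iter_sum k G (l(k + 1 := j))" for j
  proof (rule Suc.IH)
    fix l' :: "nat \<Rightarrow> nat"
    assume "\<And>i. k < i \<Longrightarrow> l' i = (l(k + 1 := j)) i"
    then show "F l' = G l'"
      by (intro Suc.prems) simp
  qed
  then show ?case by simp
qed simp

lemma iter_sum_mult_outer:
  assumes "\<And>l l'. (\<And>i. k < i \<Longrightarrow> l' i = l i) \<Longrightarrow> T l' = T l"
  shows "iter_sum k (\<lambda>l. F l * T l) l = iter_sum k F l * T l"
  using assms
proof (induction k arbitrary: l)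
  case 0
  show ?case by (simp only: iter_sum.simps)
next
  case (Suc k)
  have "iter_sum k (\<lambda>l. F l * T l) (l(k + 1 := j)) = iter_sum k F (l(k + 1 := j)) * T l" for j
  proof -
    have "T l1 = T l2" if "\<And>i. k < i \<Longrightarrow> l1 i = l2 i" for l1 l2
    proof (rule Suc.prems)
      show "l1 i = l2 i" if "Suc k < i" for i
        by (rule \<open>\<And>i. k < i \<Longrightarrow> l1 i = l2 i\<close>[OF Suc_lessD[OF that]])
    qed
    then have "iter_sum k (\<lambda>l. F l * T l) (l(k + 1 := j)) = iter_sum k F (l(k + 1 := j)) * T (l(k + 1 := j))"
      by (rule Suc.IH)
    also have "T (l(k + 1 := j)) = T l"
      by (rule Suc.prems) simp
    finally show ?thesis .
  qed
  then show ?case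
    by (simp only: iter_sum.simps sum_distrib_right)
qed

lemma layer_cong:
  assumes "1 \<le> i" "\<And>j. i \<le> j \<Longrightarrow> l' j = l j"
  shows "layer \<alpha> \<beta> n m i l' = layer \<alpha> \<beta> n m i l"
proof -
  have "l' i = l i" "l' (i + 1) = l (i + 1)" by (rule assms(2), simp)+
  moreover have "i - 1 + 1 = i" using assms(1) by simp
  ultimately show ?thesis
    by (simp only: layer_def weight_w_def norm_h_def)
qed

lemma prod_shift_pred:
  "(\<Prod>i=1..Suc t. if i = 1 then 1 else f (i - 1)) = (\<Prod>i=1..t. (f i :: real))"
  by (induction t) simp_all

lemma integrand_layers:
  assumes "1 \<le> s" "l (s + 1) = N"
  shows "Omega s l n \<alpha> \<beta> N * multiBI s n (\<lambda>i. int (l i)) \<alpha> \<beta> N * multiBI s m (\<lambda>i. int (l i)) \<alpha> \<beta> N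
    = (\<Prod>i=1..s. layer \<alpha> \<beta> n m i l)"
proof -
  have l: "l(s + 1 := N) = l" using assms(2) by auto
  have l': "(\<lambda>i. int (l i))(s + 1 := int N) = (\<lambda>i. int (l i))" using assms(2) by auto
  obtain t where s: "s = Suc t" using assms(1) by (cases s) auto
  \<comment> \<open>If some entry is too small, a weight in the numerator vanishes, so the quotient
    has the value 0 prescribed by \<open>Omega\<close>.\<close>
  have O: "Omega s l n \<alpha> \<beta> N = (\<Prod>i=1..s. weight_w i l n \<alpha> \<beta>) / (\<Prod>i=1..s-1. norm_h i l n \<alpha> \<beta>)"
  proof (cases "\<exists>i\<in>{1..s}. l i < psum n (i - 1)")
    case True
    then obtain i where "i \<in> {1..s}" "weight_w i l n \<alpha> \<beta> = 0"
      by (auto simp: weight_w_def)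
    then have "(\<Prod>i=1..s. weight_w i l n \<alpha> \<beta>) = 0"
      by (intro prod_zero) auto
    with True show ?thesis by (simp add: Omega_def l Let_def)
  next
    case False
    then show ?thesis by (simp only: Omega_def l Let_def if_False)
  qed
  have mb: "multiBI s n (\<lambda>i. int (l i)) \<alpha> \<beta> N = (\<Prod>i=1..s. BI_factor \<alpha> \<beta> n i (int (l i)) (int (l (i + 1))))" for n
    unfolding multiBI_def l' Let_def BI_factor_def ..
  have h: "(\<Prod>i=1..s. if i = 1 then 1 else norm_h (i - 1) l n \<alpha> \<beta>) = (\<Prod>i=1..s-1. norm_h i l n \<alpha> \<beta>)"
    unfolding s diff_Suc_1 by (rule prod_shift_pred)
  show ?thesis
    unfolding O mb layer_def prod_dividef prod.distrib h by simp
qed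

section \<open>Summation layer by layer\<close>

locale bannai_ito_parameters =
  fixes \<alpha> :: "nat \<Rightarrow> real" and \<beta> :: real and s :: nat
  assumes alpha_1: "\<alpha> 1 - 1 > \<beta>" and beta_pos: "\<beta> > 0"
    and alpha_gt_1: "\<And>i. 2 \<le> i \<Longrightarrow> i \<le> s + 1 \<Longrightarrow> \<alpha> i > 1"
begin

text \<open>The hypothesis \<open>\<beta> > 0\<close> gives \<rho>1 > r2, the bound on
  \<open>\<alpha> 1\<close> gives the positivity of \<rho>1 + r2 + 1/2, and
  \<open>\<alpha> (i + 1) > 1\<close> gives a positive gap. The sign of \<open>XX\<close> produces
  the two truncation cases.\<close>

lemma univariate_grid:
  assumes i: "1 \<le> i" "i \<le> s" and y: "psum n (i - 1) \<le> y"
  shows "bannai_ito_grid (rho1 \<alpha> n i) (rho2 \<alpha> n i (int y)) (rr1 \<alpha> n i (int y)) (rr2 \<alpha> \<beta> n i)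
    ((\<alpha> (i + 1) - 1) / 2) (y - psum n (i - 1))"
proof -
  have a: "asum \<alpha> 2 i \<ge> 0"
    unfolding asum_def
  proof (rule sum_nonneg)
    show "0 \<le> \<alpha> t" if "t \<in> {2..i}" for t
      using alpha_gt_1[of t] i that by simp
  qed
  have "\<alpha> (i + 1) > 1" using i by (intro alpha_gt_1) auto
  moreover note a1 = asum_split_first[OF i(1), of \<alpha>]
  have X: "XX \<alpha> n i (int y) = (if even (y - psum n (i - 1)) then 1 else -1)
      * (real (y - psum n (i - 1)) / 2 + rho1 \<alpha> n i + \<alpha> (i + 1) / 4 + 1/4)"
    using XX_truncated[OF y i(1)] by simp
  have p: "rho1 \<alpha> n i > 0"
    using a1 a alpha_1 beta_pos by (simp add: rho1_def add_nonneg_pos)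
  show ?thesis
  proof
    have "rho1 \<alpha> n i - rr2 \<alpha> \<beta> n i = real (psum n (i - 1)) + asum \<alpha> 2 i / 2 + \<beta> / 2"
      using a1 by (simp add: rho1_def rr2_def field_simps)
    then show "rho1 \<alpha> n i - rr2 \<alpha> \<beta> n i > 0"
      using a beta_pos by simp
    have "rho1 \<alpha> n i + rr2 \<alpha> \<beta> n i + 1/2 = (\<alpha> 1 - 1 - \<beta>) / 2 + 1/2"
      using a1 by (simp add: rho1_def rr2_def field_simps)
    then show "rho1 \<alpha> n i + rr2 \<alpha> \<beta> n i + 1/2 > 0"
      using alpha_1 by simp
  qed (use p \<open>\<alpha> (i + 1) > 1\<close> in \<open>simp_all add: rho2_def rr1_def X field_simps\<close>)
qed

lemma norm_h_pos:
  assumes "1 \<le> i" "i \<le> s" "psum n (i - 1) \<le> l (i + 1)"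
  shows "norm_h i l n \<alpha> \<beta> > 0"
  unfolding norm_h_def
  by (rule bannai_ito_grid.BI_h_pos[OF univariate_grid[OF assms]])

text \<open>Agreement of the earlier degrees gives both polynomials the same parameters, so the sum
  is a univariate orthogonality relation.\<close>

lemma layer_sum:
  assumes i: "1 \<le> i" "i \<le> s" and y: "psum n i \<le> l (i + 1)" and nm: "\<And>j. 1 \<le> j \<Longrightarrow> j < i \<Longrightarrow> n j = m j"
  shows "(\<Sum>j=0..l (i + 1). weight_w i (l(i := j)) n \<alpha> \<beta>
        * BI_factor \<alpha> \<beta> n i (int j) (int (l (i + 1))) * BI_factor \<alpha> \<beta> m i (int j) (int (l (i + 1))))
    = (if n i = m i then norm_h i l n \<alpha> \<beta> else 0)"
proof -
  define L where "L = psum n (i - 1)"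
  define y where "y = l (i + 1)"
  define f where "f j = weight_w i (l(i := j)) n \<alpha> \<beta> * BI_factor \<alpha> \<beta> n i (int j) (int y)
    * BI_factor \<alpha> \<beta> m i (int j) (int y)" for j
  have pi: "psum n i = L + n i"
    using i by (cases i) (auto simp: psum_def L_def)
  have Lm: "psum m (i - 1) = L"
    unfolding L_def psum_def by (intro sum.cong) (use nm in auto)
  have Ly: "L \<le> y" "n i \<le> y - L" using assms(3) pi by (auto simp: y_def)
  interpret bannai_ito_grid "rho1 \<alpha> n i" "rho2 \<alpha> n i (int y)" "rr1 \<alpha> n i (int y)" "rr2 \<alpha> \<beta> n i"
    "(\<alpha> (i + 1) - 1) / 2" "y - L"
    unfolding L_def by (rule univariate_grid) (use i Ly in \<open>auto simp: L_def\<close>)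
  have eqs: "rho1 \<alpha> m i = rho1 \<alpha> n i" "rho2 \<alpha> m i z = rho2 \<alpha> n i z" "rr1 \<alpha> m i z = rr1 \<alpha> n i z"
    "rr2 \<alpha> \<beta> m i = rr2 \<alpha> \<beta> n i" for z
    unfolding rho1_def rho2_def rr1_def rr2_def XX_def Lm L_def[symmetric] by (rule refl)+
  \<comment> \<open>Terms below \<open>L\<close> have weight 0; after the shift by \<open>L\<close>
    the sum runs over the grid indices.\<close>
  have "(\<Sum>j=0..y. f j) = (\<Sum>j\<in>{L..y}. f j)"
    by (rule sum.mono_neutral_right) (auto simp: f_def weight_w_def L_def)
  also have "\<dots> = (\<Sum>k\<le>y - L. f (k + L))"
    using sum.shift_bounds_cl_nat_ivl[of f 0 L "y - L"] Ly(1) by (simp add: atLeast0AtMost)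
  also have "\<dots> = (\<Sum>k\<le>y - L. wt k
      * BI (rho1 \<alpha> n i) (rho2 \<alpha> n i (int y)) (rr1 \<alpha> n i (int y)) (rr2 \<alpha> \<beta> n i) (n i) (node (rho1 \<alpha> n i) k)
      * BI (rho1 \<alpha> n i) (rho2 \<alpha> n i (int y)) (rr1 \<alpha> n i (int y)) (rr2 \<alpha> \<beta> n i) (m i) (node (rho1 \<alpha> n i) k))"
  proof (intro sum.cong refl)
    fix k
    have w: "weight_w i (l(i := k + L)) n \<alpha> \<beta> = wt k"
      by (simp add: weight_w_def L_def y_def)
    have "BI_factor \<alpha> \<beta> n' i (int (k + L)) (int y) = BI (rho1 \<alpha> n' i) (rho2 \<alpha> n' i (int y)) (rr1 \<alpha> n' i (int y))
        (rr2 \<alpha> \<beta> n' i) (n' i) (node (rho1 \<alpha> n' i) k)" if "psum n' (i - 1) = L" for n'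
      unfolding BI_factor_def using grid_point[of n' i "k + L" \<alpha>] that by simp
    from this[OF Lm] this[OF L_def[symmetric]]
    show "f (k + L) = wt k
      * BI (rho1 \<alpha> n i) (rho2 \<alpha> n i (int y)) (rr1 \<alpha> n i (int y)) (rr2 \<alpha> \<beta> n i) (n i) (node (rho1 \<alpha> n i) k)
      * BI (rho1 \<alpha> n i) (rho2 \<alpha> n i (int y)) (rr1 \<alpha> n i (int y)) (rr2 \<alpha> \<beta> n i) (m i) (node (rho1 \<alpha> n i) k)"
      unfolding f_def w eqs by simp
  qed
  also have "\<dots> = (if n i = m i then norm_h i l n \<alpha> \<beta> else 0)"
    unfolding BI_orthogonality[OF Ly(2)] by (simp add: norm_h_def L_def y_def)
  finally show ?thesis by (simp add: f_def y_def)
qed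

text \<open>The first \<open>k\<close> sums leave a norm that depends only on the entry of index
  \<open>k + 1\<close> and cancels the denominator of the next layer. The value 1 for
  \<open>k = 0\<close> matches the denominator 1 of the first layer.\<close>

lemma iter_sum_layers:
  assumes "k \<le> s" "psum n k \<le> l (k + 1)"
  shows "iter_sum k (\<lambda>l. \<Prod>i=1..k. layer \<alpha> \<beta> n m i l) l
    = (if \<forall>i\<in>{1..k}. n i = m i then if k = 0 then 1 else norm_h k l n \<alpha> \<beta> else 0)"
  using assms
proof (induction k arbitrary: l)
  case (Suc k)
  let ?agree = "\<forall>i\<in>{1..k}. n i = m i"
  let ?t = "\<lambda>j. weight_w (k + 1) (l(k + 1 := j)) n \<alpha> \<beta>
        * BI_factor \<alpha> \<beta> n (k + 1) (int j) (int (l (k + 1 + 1))) * BI_factor \<alpha> \<beta> m (k + 1) (int j) (int (l (k + 1 + 1)))"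
  have step: "iter_sum k (\<lambda>l. \<Prod>i=1..Suc k. layer \<alpha> \<beta> n m i l) (l(k + 1 := j)) = (if ?agree then ?t j else 0)" for j
  proof -
    let ?l = "l(k + 1 := j)"
    let ?h = "if k = 0 then 1 else norm_h k ?l n \<alpha> \<beta>"
    have "iter_sum k (\<lambda>l. \<Prod>i=1..Suc k. layer \<alpha> \<beta> n m i l) ?l
      = iter_sum k (\<lambda>l. (\<Prod>i=1..k. layer \<alpha> \<beta> n m i l) * layer \<alpha> \<beta> n m (k + 1) l) ?l"
      by simp
    also have "\<dots> = iter_sum k (\<lambda>l. \<Prod>i=1..k. layer \<alpha> \<beta> n m i l) ?l * layer \<alpha> \<beta> n m (k + 1) ?l"
    proof (rule iter_sum_mult_outer)
      fix l l' :: "nat \<Rightarrow> nat"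
      assume above: "\<And>i. k < i \<Longrightarrow> l' i = l i"
      show "layer \<alpha> \<beta> n m (k + 1) l' = layer \<alpha> \<beta> n m (k + 1) l"
        by (rule layer_cong, simp, rule above, simp)
    qed
    also have "layer \<alpha> \<beta> n m (k + 1) ?l = ?t j / ?h"
      by (simp add: layer_def)
    finally have eq: "iter_sum k (\<lambda>l. \<Prod>i=1..Suc k. layer \<alpha> \<beta> n m i l) ?l
      = iter_sum k (\<lambda>l. \<Prod>i=1..k. layer \<alpha> \<beta> n m i l) ?l * (?t j / ?h)" .
    show ?thesis
    proof (cases "j < psum n k")
      case True
      then have t: "?t j = 0" by (simp add: weight_w_def)
      show ?thesis unfolding eq t by (simp only: div_0 mult_zero_right if_cancel)
    next
      case False
      then have IH: "iter_sum k (\<lambda>l. \<Prod>i=1..k. layer \<alpha> \<beta> n m i l) ?l = (if ?agree then ?h else 0)"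
        using Suc.prems(1) by (intro Suc.IH) simp_all
      \<comment> \<open>Strict positivity justifies the cancellation of the norm.\<close>
      have "?h > 0"
      proof (cases "k = 0")
        case k: False
        have "psum n (k - 1) \<le> psum n k"
          unfolding psum_def by (intro sum_mono2) auto
        with False have "psum n (k - 1) \<le> ?l (k + 1)" by simp
        with k Suc.prems(1) norm_h_pos[of k n ?l] show ?thesis by simp
      qed simp
      moreover have "x * (y / x) = y" if "x > 0" for x y :: real
        using that by simp
      ultimately have h: "?h * (?t j / ?h) = ?t j" by blast
      show ?thesis
      proof (cases ?agree)
        case True
        show ?thesis unfolding eq IH if_P[OF True] by (rule h)
      next
        case False
        then show ?thesis unfolding eq IH by (simp only: if_False mult_zero_left)
      qed
    qed
  qed
  have "iter_sum (Suc k) (\<lambda>l. \<Prod>i=1..Suc k. layer \<alpha> \<beta> n m i l) l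
    = (\<Sum>j=0..l (k + 1 + 1). if ?agree then ?t j else 0)"
    unfolding iter_sum.simps(2) step by (simp only: add.assoc one_add_one)
  also have "\<dots> = (if ?agree then if n (k + 1) = m (k + 1) then norm_h (k + 1) l n \<alpha> \<beta> else 0 else 0)"
  proof (cases ?agree)
    case True
    then have "n j = m j" if "1 \<le> j" "j < k + 1" for j
      using that by simp
    then show ?thesis
      unfolding if_P[OF True] using Suc.prems by (intro layer_sum) auto
  next
    case False
    then show ?thesis by (simp only: if_False sum.neutral_const)
  qed
  also have "\<dots> = (if \<forall>i\<in>{1..Suc k}. n i = m i then norm_h (Suc k) l n \<alpha> \<beta> else 0)"
  proof -
    have "(\<forall>i\<in>{1..Suc k}. n i = m i) \<longleftrightarrow> ?agree \<and> n (k + 1) = m (k + 1)"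
      by (auto simp: le_Suc_eq)
    then show ?thesis by simp
  qed
  finally show ?case by (simp only: nat.distinct if_False)
qed simp

end

theorem proposition9:
  fixes s N :: nat and \<alpha> :: "nat \<Rightarrow> real" and \<beta> :: real and n m :: "nat \<Rightarrow> nat"
  assumes "1 \<le> s"
    and "\<alpha> 1 - 1 > \<beta>" and "\<beta> > 0"
    and "\<And>i. 2 \<le> i \<Longrightarrow> i \<le> s + 1 \<Longrightarrow> \<alpha> i > 1"
    and "(\<Sum>i=1..s. n i) \<le> N" and "(\<Sum>i=1..s. m i) \<le> N"
  shows "iter_sum s
           (\<lambda>l. Omega s l n \<alpha> \<beta> N
                * multiBI s n (\<lambda>i. int (l i)) \<alpha> \<beta> N
                * multiBI s m (\<lambda>i. int (l i)) \<alpha> \<beta> N)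
           ((\<lambda>_. 0)(s + 1 := N))
         = (if \<forall>i\<in>{1..s}. n i = m i then HH s n \<alpha> \<beta> N else 0)"
proof -
  interpret bannai_ito_parameters \<alpha> \<beta> s
    using assms by unfold_locales
  let ?l = "(\<lambda>_. 0)(s + 1 := N)"
  have "iter_sum s
           (\<lambda>l. Omega s l n \<alpha> \<beta> N
                * multiBI s n (\<lambda>i. int (l i)) \<alpha> \<beta> N
                * multiBI s m (\<lambda>i. int (l i)) \<alpha> \<beta> N) ?l
      = iter_sum s (\<lambda>l. \<Prod>i=1..s. layer \<alpha> \<beta> n m i l) ?l"
    by (rule iter_sum_cong, rule integrand_layers) (use assms(1) in simp_all)
  also have "\<dots> = (if \<forall>i\<in>{1..s}. n i = m i then norm_h s ?l n \<alpha> \<beta> else 0)"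
  proof -
    have "psum n s \<le> ?l (s + 1)" using assms(5) by (simp add: psum_def)
    moreover have "s \<noteq> 0" using assms(1) by simp
    ultimately show ?thesis
      using iter_sum_layers[of s n ?l m] by (simp only: order_refl if_False)
  qed
  also have "norm_h s ?l n \<alpha> \<beta> = HH s n \<alpha> \<beta> N"
    by (simp add: HH_def norm_h_def)
  finally show ?thesis .
qed

end
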